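(* For a fixed extension $\mathbb{K}\subseteq\mathbb{K}(\alpha)$ of degree $n$, the set of points at infinity $P=\{P_1,\ldots,P_n\}$ of any primitive hypercircle does not depend on the particular $\alpha$-hypercircle $\mathcal{U}$, but only on the algebraic extension and on the primitive element $\alpha$. Moreover, the set $P$ is characterized by the following property: $$\{X_0+\alpha_jX_1+\cdots+\alpha_j^{n-1}X_{n-1}=0\}\cap\overline{\mathcal{U}}=P\setminus\{P_j\},$$ where $\alpha_j=\sigma_j(\alpha)$ are the conjugates of $\alpha$ in $\mathbb{F}$, $1\le j\le n$, and $\overline{\mathcal{U}}$ is the projective closure of $\mathcal{U}$.
   Context: $\mathbb{K}$ is a field of characteristic zero, $\mathbb{L}=\mathbb{K}(\alpha)$ is a finite algebraic extension of $\mathbb{K}$ of degree $n$ with primitive element $\alpha$, and $\mathbb{F}$ is the algebraic closure of $\mathbb{K}$. A unit of $\mathbb{L}(t)$ (under composition) is a rational function $u(t)=\frac{at+b}{ct+d}$ with $a,b,c,d\in\mathbb{L}$, $ad-bc\neq 0$. Every unit $u(t)\in\mathbb{L}(t)$ is written uniquely as $u(t)=\sum_{i=0}^{n-1}\phi_i(t)\alpha^i$ with $\phi_i(t)\in\mathbb{K}(t)$, and the $\alpha$-hypercircle generated by (or associated to) $u(t)$ is the rational curve $\mathcal{U}\subseteq\mathbb{F}^n$ parametrized by $(\phi_0(t),\ldots,\phi_{n-1}(t))$ (Zariski closure of the image). An $\alpha$-hypercircle is primitive if its degree as a curve equals $n=[\mathbb{K}(\alpha):\mathbb{K}]$. $\mathbb{F}^n$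 is embedded in $\mathbb{P}(\mathbb{F})^n$ via $(X_0,\ldots,X_{n-1})\mapsto[X_0:\cdots:X_{n-1}:1]$, with hyperplane at infinity $\{X_n=0\}$. For $\mathcal{U}$ primitive generated by $u(t)=\frac{at+b}{t+d}$, write $u(t)=\frac{p_0(t)+p_1(t)\alpha+\cdots+p_{n-1}(t)\alpha^{n-1}}{M(t)}$ with $p_i\in\mathbb{K}[t]$ and $M$ the minimal polynomial of $-d$ over $\mathbb{K}$; the $n$ points at infinity of $\mathcal{U}$ are $P_j=[\sigma_j(p_0(-d)):\cdots:\sigma_j(p_{n-1}(-d)):0]$, $1\le j\le n$, where $\sigma_1=\mathrm{Id},\sigma_2,\ldots,\sigma_n$ are $\mathbb{K}$-automorphisms of the normal closure of $\mathbb{L}$ over $\mathbb{K}$ such that $\alpha_j=\sigma_j(\alpha)$, $1\le j\le n$, are the $n$ conjugates of $\alpha=\alpha_1$.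
   Formalization: The displayed equation is proved for points at infinity only (intersected with X_n=0); read in projective n-space it fails, e.g. K=Q, α=i, u=t/(t+i), whose circle X_0²+X_1²=X_0 passes through the origin, an extra point of the intersection. *)

theory Defs
  imports
    "HOL-Algebra.Algebraic_Closure_Type"
    "HOL-Computational_Algebra.Normalized_Fraction"
    "HOL-Library.Poly_Mapping"
    "Jordan_Normal_Form.Matrix"
begin

text \<open>
  The base field \<open>\<bbbK>\<close> is a type \<open>'k\<close> of characteristic zero, \<open>\<bbbF>\<close> is its algebraic closure
  \<^typ>\<open>'k alg_closure\<close>, and \<open>\<bbbK>\<close> is identified with the range of \<^const>\<open>to_ac\<close>.  All intermediate
  fields are subsets of \<open>\<bbbF>\<close>; all rational functions live in \<open>\<bbbF>(t)\<close>,
  i.e. \<^typ>\<open>'k alg_closure poly fract\<close>.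
\<close>

section \<open>Field extensions\<close>

definition is_subfield :: "'a::field set \<Rightarrow> bool" where
  "is_subfield E \<longleftrightarrow> 0 \<in> E \<and> 1 \<in> E \<and>
     (\<forall>x\<in>E. \<forall>y\<in>E. x + y \<in> E \<and> x * y \<in> E) \<and> (\<forall>x\<in>E. - x \<in> E \<and> inverse x \<in> E)"

definition adjoin :: "'k::field_char_0 alg_closure \<Rightarrow> 'k alg_closure set" where
  "adjoin \<alpha> = is_subfield hull (insert \<alpha> (range to_ac))"

definition ext_degree :: "'k::field_char_0 alg_closure set \<Rightarrow> nat" where
  "ext_degree E = vector_space.dim (\<lambda>(k::'k) x. to_ac k * x) E"

definition minimal_poly :: "'k::field_char_0 alg_closure \<Rightarrow> 'k poly" where
  "minimal_poly x = (THE p. lead_coeff p = 1 \<and> poly (map_poly to_ac p) x = 0 \<and>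
     (\<forall>q. q \<noteq> 0 \<and> poly (map_poly to_ac q) x = 0 \<longrightarrow> degree p \<le> degree q))"

definition conjugates :: "'k::field_char_0 alg_closure \<Rightarrow> 'k alg_closure set" where
  "conjugates x = {y. poly (map_poly to_ac (minimal_poly x)) y = 0}"

text \<open>
  As \<open>\<bbbF>\<close> is algebraically closed, an intermediate field is normal over \<open>\<bbbK>\<close> (minimal polynomials
  of its elements split in it) iff it contains all conjugates of its elements.
\<close>

definition normal_closure :: "'k::field_char_0 alg_closure set \<Rightarrow> 'k alg_closure set" where
  "normal_closure E =
     (\<lambda>N. is_subfield N \<and> range to_ac \<subseteq> N \<and> (\<forall>x\<in>N. conjugates x \<subseteq> N)) hull E"

definition base_automorphism ::
    "'k::field_char_0 alg_closure set \<Rightarrow> ('k alg_closure \<Rightarrow> 'k alg_closure) \<Rightarrow> bool" where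
  "base_automorphism N f \<longleftrightarrow> bij_betw f N N \<and>
     (\<forall>x\<in>N. \<forall>y\<in>N. f (x + y) = f x + f y \<and> f (x * y) = f x * f y) \<and>
     (\<forall>k. f (to_ac k) = to_ac k)"

definition conjugating_automorphisms ::
    "'k::field_char_0 alg_closure \<Rightarrow> (nat \<Rightarrow> 'k alg_closure \<Rightarrow> 'k alg_closure) \<Rightarrow> bool" where
  "conjugating_automorphisms \<alpha> \<sigma> \<longleftrightarrow>
     (\<forall>x\<in>normal_closure (adjoin \<alpha>). \<sigma> 1 x = x) \<and>
     (\<forall>j\<in>{1..ext_degree (adjoin \<alpha>)}. base_automorphism (normal_closure (adjoin \<alpha>)) (\<sigma> j)) \<and>
     bij_betw (\<lambda>j. \<sigma> j \<alpha>) {1..ext_degree (adjoin \<alpha>)} (conjugates \<alpha>)"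

section \<open>Rational functions\<close>

definition base_rat_funs :: "'k::field_char_0 alg_closure poly fract set" where
  "base_rat_funs = {Fract (map_poly to_ac p) (map_poly to_ac q) |(p::'k poly) q. q \<noteq> 0}"

definition rat_defined :: "'k::field_char_0 alg_closure poly fract \<Rightarrow> 'k alg_closure \<Rightarrow> bool" where
  "rat_defined f t \<longleftrightarrow> poly (snd (quot_of_fract f)) t \<noteq> 0"

definition rat_eval :: "'k::field_char_0 alg_closure poly fract \<Rightarrow> 'k alg_closure \<Rightarrow> 'k alg_closure" where
  "rat_eval f t = poly (fst (quot_of_fract f)) t / poly (snd (quot_of_fract f)) t"

text \<open>The coefficient list \<open>[:b, a:]\<close> is the polynomial \<open>a t + b\<close>.\<close>

definition is_unit_over ::
    "'k::field_char_0 alg_closure set \<Rightarrow> 'k alg_closure poly fract \<Rightarrow> bool" where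
  "is_unit_over E u \<longleftrightarrow> (\<exists>a\<in>E. \<exists>b\<in>E. \<exists>c\<in>E. \<exists>d\<in>E. a * d - b * c \<noteq> 0 \<and> u = Fract [:b, a:] [:d, c:])"

section \<open>Affine and projective varieties\<close>

text \<open>Polynomials in the variables \<open>X\<^sub>0, X\<^sub>1, \<dots>\<close>, as finitely supported maps from monomials to
  coefficients.\<close>

type_synonym 'a mpoly = "(nat \<Rightarrow>\<^sub>0 nat) \<Rightarrow>\<^sub>0 'a"

definition in_vars :: "nat \<Rightarrow> 'a::zero mpoly \<Rightarrow> bool" where
  "in_vars m p \<longleftrightarrow> (\<forall>e\<in>Poly_Mapping.keys p. Poly_Mapping.keys e \<subseteq> {..<m})"

definition mpoly_homogeneous :: "'a::zero mpoly \<Rightarrow> bool" where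
  "mpoly_homogeneous p \<longleftrightarrow> (\<exists>k. \<forall>e\<in>Poly_Mapping.keys p. (\<Sum>i\<in>Poly_Mapping.keys e. Poly_Mapping.lookup e i) = k)"

definition mpoly_eval :: "'a::comm_semiring_1 mpoly \<Rightarrow> 'a vec \<Rightarrow> 'a" where
  "mpoly_eval p v = (\<Sum>e\<in>Poly_Mapping.keys p. Poly_Mapping.lookup p e * (\<Prod>i\<in>Poly_Mapping.keys e. (v $ i) ^ Poly_Mapping.lookup e i))"

definition zariski_closure :: "nat \<Rightarrow> 'a::field vec set \<Rightarrow> 'a vec set" where
  "zariski_closure n S = {x \<in> carrier_vec n.
     \<forall>p. in_vars n p \<and> (\<forall>y\<in>S. mpoly_eval p y = 0) \<longrightarrow> mpoly_eval p x = 0}"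

text \<open>A point of projective \<open>n\<close>-space is the set of its homogeneous coordinate vectors
  \<open>(X\<^sub>0, \<dots>, X\<^sub>n)\<close>.\<close>

definition proj_point :: "'a::field vec \<Rightarrow> 'a vec set" where
  "proj_point v = {c \<cdot>\<^sub>v v |c. c \<noteq> 0}"

definition proj_space :: "nat \<Rightarrow> 'a::field vec set set" where
  "proj_space n = proj_point ` (carrier_vec (n + 1) - {0\<^sub>v (n + 1)})"

definition affine_embed :: "nat \<Rightarrow> 'a::field vec \<Rightarrow> 'a vec set" where
  "affine_embed n x = proj_point (vec (n + 1) (\<lambda>i. if i < n then x $ i else 1))"

definition proj_zariski_closure :: "nat \<Rightarrow> 'a::field vec set set \<Rightarrow> 'a vec set set" where
  "proj_zariski_closure n S = {Q \<in> proj_space n.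
     \<forall>p. in_vars (n + 1) p \<and> mpoly_homogeneous p \<and> (\<forall>R\<in>S. \<forall>v\<in>R. mpoly_eval p v = 0) \<longrightarrow>
       (\<forall>v\<in>Q. mpoly_eval p v = 0)}"

definition proj_closure :: "nat \<Rightarrow> 'a::field vec set \<Rightarrow> 'a vec set set" where
  "proj_closure n U = proj_zariski_closure n (affine_embed n ` U)"

definition proj_hyperplane :: "nat \<Rightarrow> 'a::field vec \<Rightarrow> 'a vec set set" where
  "proj_hyperplane n h = {Q \<in> proj_space n. \<forall>v\<in>Q. h \<bullet> v = 0}"

definition hyperplane_at_infinity :: "nat \<Rightarrow> 'a::field vec set set" where
  "hyperplane_at_infinity n = proj_hyperplane n (unit_vec (n + 1) n)"

text \<open>The degree of a projective curve is the number of its intersection points with a generic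
  hyperplane, i.e. with every hyperplane in a nonempty Zariski-open subset \<open>{G \<noteq> 0}\<close> of the dual
  projective space.\<close>

definition curve_has_degree :: "nat \<Rightarrow> 'a::field vec set set \<Rightarrow> nat \<Rightarrow> bool" where
  "curve_has_degree n C d \<longleftrightarrow> (\<exists>G. G \<noteq> 0 \<and> in_vars (n + 1) G \<and> mpoly_homogeneous G \<and>
     (\<forall>h \<in> carrier_vec (n + 1) - {0\<^sub>v (n + 1)}. mpoly_eval G h \<noteq> 0 \<longrightarrow>
        finite (C \<inter> proj_hyperplane n h) \<and> card (C \<inter> proj_hyperplane n h) = d))"

section \<open>Hypercircles\<close>

text \<open>The coordinates are unique for indices below the degree; values at larger indices are
  arbitrary and never used.\<close>

definition alpha_coords ::
    "'k::field_char_0 alg_closure \<Rightarrow> 'k alg_closure poly fract \<Rightarrow> nat \<Rightarrow> 'k alg_closure poly fract" where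
  "alpha_coords \<alpha> u = (SOME \<phi>. (\<forall>i<ext_degree (adjoin \<alpha>). \<phi> i \<in> base_rat_funs) \<and>
     u = (\<Sum>i<ext_degree (adjoin \<alpha>). \<phi> i * to_fract [:\<alpha> ^ i:]))"

definition hypercircle ::
    "'k::field_char_0 alg_closure \<Rightarrow> 'k alg_closure poly fract \<Rightarrow> 'k alg_closure vec set" where
  "hypercircle \<alpha> u = (let n = ext_degree (adjoin \<alpha>); \<phi> = alpha_coords \<alpha> u in
     zariski_closure n {vec n (\<lambda>i. rat_eval (\<phi> i) t) |t. \<forall>i<n. rat_defined (\<phi> i) t})"

definition is_hypercircle :: "'k::field_char_0 alg_closure \<Rightarrow> 'k alg_closure vec set \<Rightarrow> bool" where
  "is_hypercircle \<alpha> U \<longleftrightarrow> (\<exists>u. is_unit_over (adjoin \<alpha>) u \<and> U = hypercircle \<alpha> u)"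

definition primitive_hypercircle ::
    "'k::field_char_0 alg_closure \<Rightarrow> 'k alg_closure vec set \<Rightarrow> bool" where
  "primitive_hypercircle \<alpha> U \<longleftrightarrow> is_hypercircle \<alpha> U \<and>
     (let n = ext_degree (adjoin \<alpha>) in curve_has_degree n (proj_closure n U) n)"

text \<open>\<open>u(t) = (a t + b) / (t + d)\<close> is a unit generating \<open>U\<close> and
  \<open>u = (p\<^sub>0 + p\<^sub>1 \<alpha> + \<dots> + p\<^sub>n\<^sub>-\<^sub>1 \<alpha>\<^sup>n\<^sup>-\<^sup>1) / M\<close> with \<open>p\<^sub>i\<close> over \<open>\<bbbK>\<close> and \<open>M\<close> the minimal polynomial of \<open>-d\<close>.\<close>

definition generated_by ::
    "'k::field_char_0 alg_closure \<Rightarrow> 'k alg_closure vec set \<Rightarrow>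
     'k alg_closure \<Rightarrow> 'k alg_closure \<Rightarrow> 'k alg_closure \<Rightarrow> (nat \<Rightarrow> 'k poly) \<Rightarrow> bool" where
  "generated_by \<alpha> U a b d p \<longleftrightarrow>
     a \<in> adjoin \<alpha> \<and> b \<in> adjoin \<alpha> \<and> d \<in> adjoin \<alpha> \<and> a * d - b \<noteq> 0 \<and>
     U = hypercircle \<alpha> (Fract [:b, a:] [:d, 1:]) \<and>
     Fract [:b, a:] [:d, 1:] =
       Fract (\<Sum>i<ext_degree (adjoin \<alpha>). smult (\<alpha> ^ i) (map_poly to_ac (p i)))
             (map_poly to_ac (minimal_poly (- d)))"

definition infinity_point ::
    "nat \<Rightarrow> ('k::field_char_0 alg_closure \<Rightarrow> 'k alg_closure) \<Rightarrow> 'k alg_closure \<Rightarrow> (nat \<Rightarrow> 'k poly) \<Rightarrow>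
     'k alg_closure vec set" where
  "infinity_point n s d p = proj_point
     (vec (n + 1) (\<lambda>i. if i < n then s (poly (map_poly to_ac (p i)) (- d)) else 0))"

text \<open>The hyperplane \<open>X\<^sub>0 + x X\<^sub>1 + \<dots> + x\<^sup>n\<^sup>-\<^sup>1 X\<^sub>n\<^sub>-\<^sub>1 = 0\<close> of projective
  \<open>n\<close>-space.  Besides points at infinity it also contains affine points: for \<open>\<alpha> = \<i>\<close> over the rationals,
  \<open>u = t / (t + \<i>)\<close> generates the circle \<open>X\<^sub>0\<^sup>2 + X\<^sub>1\<^sup>2 = X\<^sub>0\<close>, which passes through the origin.  Hence in
  statements on points at infinity it has to be intersected with the hyperplane at infinity.\<close>

definition conj_hyperplane :: "nat \<Rightarrow> 'a::field \<Rightarrow> 'a vec set set" where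
  "conj_hyperplane n x = proj_hyperplane n (vec (n + 1) (\<lambda>i. if i < n then x ^ i else 0))"

end

theory Submission
  imports Defs
begin

text \<open>
  Put \<open>Y\<^sub>j = X\<^sub>0 + \<alpha>\<^sub>j X\<^sub>1 + \<dots> + \<alpha>\<^sub>j\<^sup>n\<^sup>-\<^sup>1 X\<^sub>n\<^sub>-\<^sub>1\<close>.  These are linear coordinates because the Vandermonde matrix
  of the conjugates is invertible, and applying \<open>\<sigma>\<^sub>j\<close> to \<open>u = \<Sum> \<phi>\<^sub>i \<alpha>\<^sup>i\<close> shows that on the hypercircle
  \<open>Y\<^sub>j = \<sigma>\<^sub>j(u)(t)\<close> is a Moebius transformation of the parameter.  Eliminating \<open>t\<close> from \<open>Y\<^sub>i\<close> and \<open>Y\<^sub>j\<close>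
  gives a bilinear relation, whose leading coefficient vanishes iff \<open>\<sigma>\<^sub>i(u)\<close> and \<open>\<sigma>\<^sub>j(u)\<close> have the same
  pole.  If the \<open>n\<close> poles are distinct, the relations read \<open>Y\<^sub>i Y\<^sub>j = 0\<close> at infinity, so the points at
  infinity are the \<open>n\<close> coordinate points of the \<open>Y\<^sub>j\<close>, the coefficient vectors of the Lagrange basis
  polynomials of \<open>\<alpha>\<^sub>1, \<dots>, \<alpha>\<^sub>n\<close>; these depend on \<open>\<alpha>\<close> only.  If two poles coincide, a generic hyperplane
  meets the curve in fewer than \<open>n\<close> points, so the hypercircle is not primitive.
\<close>

text \<open>Primitivity is given only as a count of hyperplane sections valid where an unknown form
  \<open>G\<close> is nonzero. To refute degree n, one hyperplane \<open>h\<close> with G(h) ~= 0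
  and fewer than n intersection points is enough. Such an \<open>h\<close> is made to miss the
  finitely many points of the closure without a finite parameter, namely the image of t = infinity
  and the points at infinity. Its section is then counted by the zeros of one rational function of
  t. With a repeated pole, n - 1 denominators suffice, and clearing them leaves a polynomial of
  degree at most n - 1.

  The bilinear relations only bound the closure from above. That the n candidate points really lie
  on it needs a separate limit argument: a form vanishing on the curve becomes, along polynomial
  homogeneous coordinates, a polynomial in t with infinitely many roots, so it also vanishes at the
  pole.

  The intersection property determines the labelled points because Q_j lies on all the hyperplanes
  with index k ~= j. At infinity these leave only the coordinate Y_j free, hence a single
  point.\<close>

no_notation fps_nth (infixl \<open>$\<close> 75)

section \<open>Evaluation of polynomials in several variables\<close>

definition mon_eval :: "(nat \<Rightarrow>\<^sub>0 nat) \<Rightarrow> 'a::comm_semiring_1 vec \<Rightarrow> 'a" where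
  "mon_eval e v = (\<Prod>i\<in>Poly_Mapping.keys e. (v $ i) ^ Poly_Mapping.lookup e i)"

text \<open>Addition can shrink key sets by cancellation. Summing over a fixed finite superset lets
  evaluations be compared term by term.\<close>

lemma mpoly_eval_superset:
  fixes p :: "'a::comm_semiring_1 mpoly"
  assumes "finite A" "Poly_Mapping.keys p \<subseteq> A"
  shows "mpoly_eval p v = (\<Sum>e\<in>A. Poly_Mapping.lookup p e * mon_eval e v)"
  unfolding mpoly_eval_def mon_eval_def
  by (rule sum.mono_neutral_left) (use assms in \<open>auto simp: in_keys_iff\<close>)

lemma mon_eval_superset:
  assumes "finite A" "Poly_Mapping.keys e \<subseteq> A"
  shows "mon_eval e v = (\<Prod>i\<in>A. (v $ i) ^ Poly_Mapping.lookup e i)"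
  unfolding mon_eval_def
  by (rule prod.mono_neutral_left) (use assms in \<open>auto simp: in_keys_iff\<close>)

lemma mon_eval_zero [simp]: "mon_eval 0 v = 1"
  by (simp add: mon_eval_def)

lemma mon_eval_add: "mon_eval (e + f) v = mon_eval e v * mon_eval f v"
proof -
  let ?A = "Poly_Mapping.keys e \<union> Poly_Mapping.keys f"
  have "Poly_Mapping.keys (e + f) \<subseteq> ?A" by (rule keys_add)
  then show ?thesis
    by (simp add: mon_eval_superset[of ?A] lookup_add power_add prod.distrib)
qed

lemma mpoly_eval_zero [simp]: "mpoly_eval 0 v = 0"
  by (simp add: mpoly_eval_def)

lemma mpoly_eval_add:
  fixes p q :: "'a::comm_semiring_1 mpoly"
  shows "mpoly_eval (p + q) v = mpoly_eval p v + mpoly_eval q v"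
proof -
  let ?A = "Poly_Mapping.keys p \<union> Poly_Mapping.keys q"
  have "Poly_Mapping.keys (p + q) \<subseteq> ?A" by (rule keys_add)
  then show ?thesis
    by (simp add: mpoly_eval_superset[of ?A] lookup_add algebra_simps sum.distrib)
qed

lemma mpoly_eval_single:
  "mpoly_eval (Poly_Mapping.single e c) v = c * mon_eval e v"
  by (simp add: mpoly_eval_superset[of "{e}"] lookup_single)

lemma mpoly_eval_sum:
  fixes p :: "'i \<Rightarrow> 'a::comm_semiring_1 mpoly"
  shows "mpoly_eval (\<Sum>i\<in>I. p i) v = (\<Sum>i\<in>I. mpoly_eval (p i) v)"
  by (induction I rule: infinite_finite_induct) (auto simp: mpoly_eval_add)

text \<open>A monomial is encoded by the list of its variables with repetition, so its total degree
  is the length of the list and its value is a plain product. Forms of degree 1 and 2 are then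
  families of lists of length 1 and 2.\<close>

definition mon_of_list :: "nat list \<Rightarrow> (nat \<Rightarrow>\<^sub>0 nat)" where
  "mon_of_list ks = (\<Sum>k\<leftarrow>ks. Poly_Mapping.single k 1)"

lemma mon_eval_of_list: "mon_eval (mon_of_list ks) v = prod_list (map (\<lambda>k. v $ k) ks)"
proof (induction ks)
  case Nil
  then show ?case by (simp add: mon_of_list_def)
next
  case (Cons k ks)
  have "mon_eval (Poly_Mapping.single k 1) v = v $ k"
    by (simp add: mon_eval_def)
  with Cons show ?case by (simp add: mon_of_list_def mon_eval_add)
qed

lemma keys_mon_of_list: "Poly_Mapping.keys (mon_of_list ks) \<subseteq> set ks"
proof (induction ks)
  case (Cons k ks)
  then show ?case
    using keys_add[of "Poly_Mapping.single k 1" "mon_of_list ks"]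
    by (auto simp: mon_of_list_def)
qed (simp add: mon_of_list_def)

lemma degree_mon_of_list:
  "(\<Sum>i\<in>Poly_Mapping.keys (mon_of_list ks). Poly_Mapping.lookup (mon_of_list ks) i) = length ks"
proof -
  have *: "(\<Sum>i\<in>A. Poly_Mapping.lookup (mon_of_list ks) i) = length ks"
    if "finite A" "set ks \<subseteq> A" for A
    using that(2)
  proof (induction ks)
    case (Cons k ks)
    have "(\<Sum>i\<in>A. Poly_Mapping.lookup (mon_of_list (k # ks)) i)
        = (\<Sum>i\<in>A. if i = k then 1 else 0) + (\<Sum>i\<in>A. Poly_Mapping.lookup (mon_of_list ks) i)"
      by (auto simp: mon_of_list_def lookup_add lookup_single sum.distrib[symmetric] when_def
          intro!: sum.cong)
    with Cons that(1) show ?case by simp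
  qed (simp add: mon_of_list_def)
  have "(\<Sum>i\<in>Poly_Mapping.keys (mon_of_list ks). Poly_Mapping.lookup (mon_of_list ks) i)
      = (\<Sum>i\<in>set ks. Poly_Mapping.lookup (mon_of_list ks) i)"
    by (rule sum.mono_neutral_left) (use keys_mon_of_list in \<open>auto simp: in_keys_iff\<close>)
  with * show ?thesis by simp
qed

lemma keys_sum_single:
  assumes "e \<in> Poly_Mapping.keys (\<Sum>i\<in>I. Poly_Mapping.single (f i) (c i))"
  shows "\<exists>i\<in>I. e = f i"
  using assms
proof (induction I rule: infinite_finite_induct)
  case (insert x F)
  then show ?case
    using keys_add[of "Poly_Mapping.single (f x) (c x)" "\<Sum>i\<in>F. Poly_Mapping.single (f i) (c i)"]
    by (auto split: if_splits)
qed auto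

lemma mpoly_eval_homogeneous:
  fixes p :: "'a::comm_semiring_1 mpoly"
  assumes "in_vars m p" "mpoly_homogeneous p"
  obtains k where "\<And>c v. v \<in> carrier_vec m \<Longrightarrow> mpoly_eval p (c \<cdot>\<^sub>v v) = c ^ k * mpoly_eval p v"
proof -
  from assms(2) obtain k where
    k: "\<And>e. e \<in> Poly_Mapping.keys p \<Longrightarrow> (\<Sum>i\<in>Poly_Mapping.keys e. Poly_Mapping.lookup e i) = k"
    by (auto simp: mpoly_homogeneous_def)
  have "mpoly_eval p (c \<cdot>\<^sub>v v) = c ^ k * mpoly_eval p v" if v: "v \<in> carrier_vec m" for c v
  proof -
    have "mon_eval e (c \<cdot>\<^sub>v v) = c ^ k * mon_eval e v" if e: "e \<in> Poly_Mapping.keys p" for e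
    proof -
      have "Poly_Mapping.keys e \<subseteq> {..<m}" using assms(1) e by (auto simp: in_vars_def)
      then have "mon_eval e (c \<cdot>\<^sub>v v) =
          (\<Prod>i\<in>Poly_Mapping.keys e. c ^ Poly_Mapping.lookup e i * (v $ i) ^ Poly_Mapping.lookup e i)"
        unfolding mon_eval_def
        by (intro prod.cong) (use v in \<open>auto simp: power_mult_distrib\<close>)
      also have "\<dots> = c ^ k * mon_eval e v"
        using k[OF e] by (simp add: prod.distrib mon_eval_def power_sum[symmetric])
      finally show ?thesis .
    qed
    then show ?thesis
      by (auto simp: mpoly_eval_superset[of "Poly_Mapping.keys p"] sum_distrib_left ac_simps
          intro!: sum.cong)
  qed
  with that show ?thesis by blast
qed

text \<open>Restricts a polynomial in several variables to a polynomial curve, where vanishing at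
  infinitely many parameters forces vanishing everywhere.\<close>

lemma mpoly_eval_poly:
  fixes p :: "'a::comm_ring_1 mpoly" and w :: "nat \<Rightarrow> 'a poly"
  assumes "in_vars m p"
  obtains q where "\<And>t. poly q t = mpoly_eval p (vec m (\<lambda>i. poly (w i) t))"
proof
  fix t
  show "poly (\<Sum>e\<in>Poly_Mapping.keys p. smult (Poly_Mapping.lookup p e)
          (\<Prod>i\<in>Poly_Mapping.keys e. w i ^ Poly_Mapping.lookup e i)) t
      = mpoly_eval p (vec m (\<lambda>i. poly (w i) t))"
    unfolding mpoly_eval_def poly_sum poly_smult poly_prod poly_power
    using assms by (intro sum.cong arg_cong2[of _ _ _ _ "(*)"] prod.cong)
      (auto simp: in_vars_def subset_eq)
qed

section \<open>Generic hyperplanes\<close>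

text \<open>Uniqueness of base \<open>N\<close> digits: the residue modulo \<open>N\<close> gives
  the lowest digit, and what remains is the shifted digit sequence.\<close>

lemma digit_sum_inj:
  fixes e f :: "nat \<Rightarrow> nat"
  assumes "\<And>i. i < m \<Longrightarrow> e i < N" "\<And>i. i < m \<Longrightarrow> f i < N"
    and "(\<Sum>i<m. e i * N ^ i) = (\<Sum>i<m. f i * N ^ i)" "i < m"
  shows "e i = f i"
  using assms
proof (induction m arbitrary: e f i)
  case (Suc m)
  have split: "(\<Sum>i<Suc m. g i * N ^ i) = g 0 + N * (\<Sum>i<m. g (Suc i) * N ^ i)" for g :: "nat \<Rightarrow> nat"
    by (simp add: sum.lessThan_Suc_shift sum_distrib_left ac_simps del: sum.lessThan_Suc)
  have eq: "e 0 + N * (\<Sum>i<m. e (Suc i) * N ^ i) = f 0 + N * (\<Sum>i<m. f (Suc i) * N ^ i)"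
    using Suc.prems(3) unfolding split .
  have lt: "e 0 < N" "f 0 < N" using Suc.prems(1,2) by auto
  have 0: "e 0 = f 0"
    using arg_cong[OF eq, of "\<lambda>x. x mod N"] lt by simp
  with eq lt have eq': "(\<Sum>i<m. e (Suc i) * N ^ i) = (\<Sum>i<m. f (Suc i) * N ^ i)" by simp
  show ?case
  proof (cases i)
    case (Suc k)
    have "e (Suc k) = f (Suc k)"
      using Suc.IH[of "\<lambda>i. e (Suc i)" "\<lambda>i. f (Suc i)" k] Suc.prems(1,2,4) eq' Suc by auto
    with Suc show ?thesis by simp
  qed (use 0 in simp)
qed simp

text \<open>Kronecker substitution: along the curve \<open>(s ^ N ^ 0, s ^ N ^ 1, \<dots>)\<close> with \<open>N\<close> large, distinct
  monomials become distinct powers of \<open>s\<close>, so finitely many nonzero polynomials have a common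
  non-root on it.\<close>

lemma generic_point:
  fixes G :: "'a::field_char_0 mpoly"
  assumes "G \<noteq> 0" "in_vars m G" "finite S" and S: "\<And>v. v \<in> S \<Longrightarrow> v \<in> carrier_vec m \<and> v \<noteq> 0\<^sub>v m"
  obtains h where "h \<in> carrier_vec m" "mpoly_eval G h \<noteq> 0" "\<And>v. v \<in> S \<Longrightarrow> h \<bullet> v \<noteq> 0"
proof -
  let ?E = "(\<lambda>(e, i). Poly_Mapping.lookup e i) ` (Poly_Mapping.keys G \<times> {..<m})"
  \<comment> \<open>All exponents in \<open>G\<close> are below \<open>N\<close>, so
    \<open>code e\<close> has the exponents of \<open>e\<close> as its base \<open>N\<close> digits.
    The second \<open>Suc\<close> gives N >= 2, which keeps the exponents N ^ i of the linear forms
    \<open>l v\<close> distinct.\<close>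
  define N where "N = Suc (Suc (Max (insert 0 ?E)))"
  have N2: "N \<ge> 2" by (simp add: N_def)
  have lt: "Poly_Mapping.lookup e i < N" if "e \<in> Poly_Mapping.keys G" "i < m" for e i
  proof -
    have "Poly_Mapping.lookup e i \<in> insert 0 ?E" using that by force
    then have "Poly_Mapping.lookup e i \<le> Max (insert 0 ?E)" by (intro Max_ge) auto
    then show ?thesis by (simp add: N_def)
  qed
  define code where "code e = (\<Sum>i<m. Poly_Mapping.lookup e i * N ^ i)" for e :: "nat \<Rightarrow>\<^sub>0 nat"
  have keys: "Poly_Mapping.keys e \<subseteq> {..<m}" if "e \<in> Poly_Mapping.keys G" for e
    using assms(2) that by (auto simp: in_vars_def)
  have inj: "inj_on code (Poly_Mapping.keys G)"
  proof (rule inj_onI)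
    fix e f assume e: "e \<in> Poly_Mapping.keys G" and f: "f \<in> Poly_Mapping.keys G" and eq: "code e = code f"
    show "e = f"
    proof (rule poly_mapping_eqI)
      fix i
      show "Poly_Mapping.lookup e i = Poly_Mapping.lookup f i"
      proof (cases "i < m")
        case True
        show ?thesis
          by (rule digit_sum_inj[where m = m and N = N])
            (use lt e f eq True in \<open>auto simp: code_def\<close>)
      next
        case False
        then show ?thesis using keys[OF e] keys[OF f]
          by (metis in_keys_iff lessThan_iff subsetD)
      qed
    qed
  qed
  define g where "g = (\<Sum>e\<in>Poly_Mapping.keys G. monom (Poly_Mapping.lookup G e) (code e))"
  define h where "h s = vec m (\<lambda>i. s ^ (N ^ i))" for s :: 'a
  have poly_g: "poly g s = mpoly_eval G (h s)" for s
  proof -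
    have "mon_eval e (h s) = s ^ code e" if "e \<in> Poly_Mapping.keys G" for e
      using keys[OF that]
      by (simp add: mon_eval_superset[of "{..<m}"] h_def code_def power_sum power_mult[symmetric] mult.commute)
    then show ?thesis
      by (auto simp: g_def poly_sum poly_monom mpoly_eval_superset[of "Poly_Mapping.keys G"] intro!: sum.cong)
  qed
  obtain e0 where e0: "e0 \<in> Poly_Mapping.keys G"
    using assms(1) by (metis in_keys_iff lookup_zero poly_mapping_eqI)
  have "coeff g (code e0) = (\<Sum>e\<in>Poly_Mapping.keys G. if e = e0 then Poly_Mapping.lookup G e else 0)"
    unfolding g_def coeff_sum by (intro sum.cong) (use inj e0 in \<open>auto simp: inj_on_def\<close>)
  also have "\<dots> = Poly_Mapping.lookup G e0" using e0 by simp
  finally have "coeff g (code e0) \<noteq> 0" using e0 by (simp add: in_keys_iff)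
  then have g0: "g \<noteq> 0" by auto
  define l where "l v = (\<Sum>i<m. monom (v $ i) (N ^ i))" for v :: "'a vec"
  have poly_l: "poly (l v) s = h s \<bullet> v" if "v \<in> carrier_vec m" for v s
    using that
    by (auto simp: l_def poly_sum poly_monom scalar_prod_def h_def atLeast0LessThan intro!: sum.cong)
  have l0: "l v \<noteq> 0" if v: "v \<in> S" for v
  proof -
    from S[OF v] obtain i where i: "i < m" "v $ i \<noteq> 0"
      by (metis carrier_vecD eq_vecI index_zero_vec)
    have "coeff (l v) (N ^ i) = (\<Sum>k<m. if k = i then v $ k else 0)"
      unfolding l_def coeff_sum by (intro sum.cong) (use N2 in auto)
    also have "\<dots> = v $ i" using i by simp
    finally show ?thesis using i by auto
  qed
  have "finite ({s. poly g s = 0} \<union> (\<Union>v\<in>S. {s. poly (l v) s = 0}))"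
    using g0 l0 assms(3) by (auto intro: poly_roots_finite)
  then obtain s where "s \<notin> {s. poly g s = 0} \<union> (\<Union>v\<in>S. {s. poly (l v) s = 0})"
    using ex_new_if_finite[OF infinite_UNIV_char_0] by blast
  then show ?thesis
    by (intro that[of "h s"]) (use S poly_g poly_l in \<open>auto simp: h_def\<close>)
qed

section \<open>Projective closures\<close>

definition homogenize :: "nat \<Rightarrow> 'a::field vec \<Rightarrow> 'a vec" where
  "homogenize n x = vec (n + 1) (\<lambda>i. if i < n then x $ i else 1)"

lemma homogenize_carrier [simp]:
  "homogenize n x \<in> carrier_vec (n + 1)" "homogenize n x \<in> carrier_vec (Suc n)"
  by (simp_all add: homogenize_def)

section \<open>Representatives of projective points\<close>

lemma mem_proj_point_self: "v \<in> proj_point v"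
  unfolding proj_point_def by (rule CollectI, rule exI[of _ 1]) auto

lemma proj_point_smult:
  assumes "c \<noteq> 0"
  shows "proj_point (c \<cdot>\<^sub>v v) = proj_point v"
proof -
  have "k \<cdot>\<^sub>v v = (k / c) \<cdot>\<^sub>v (c \<cdot>\<^sub>v v)" for k
    using assms by (simp add: smult_smult_assoc)
  with assms show ?thesis
    unfolding proj_point_def
    by (smt (verit, ccfv_threshold) Collect_cong divide_eq_0_iff mult_eq_0_iff smult_smult_assoc)
qed

lemma proj_space_mem:
  assumes "Q \<in> proj_space n" "v \<in> Q"
  shows "v \<in> carrier_vec (n + 1)" "v \<noteq> 0\<^sub>v (n + 1)" "Q = proj_point v"
proof -
  from assms(1) obtain w where w: "w \<in> carrier_vec (n + 1)" "w \<noteq> 0\<^sub>v (n + 1)" "Q = proj_point w"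
    by (auto simp: proj_space_def)
  with assms(2) obtain c where c: "c \<noteq> 0" "v = c \<cdot>\<^sub>v w" by (auto simp: proj_point_def)
  show "v \<in> carrier_vec (n + 1)" "Q = proj_point v" using w c by (auto simp: proj_point_smult)
  show "v \<noteq> 0\<^sub>v (n + 1)"
  proof
    assume *: "v = 0\<^sub>v (n + 1)"
    have "w $ i = 0" if "i < n + 1" for i
      using arg_cong[OF *, of "\<lambda>u. u $ i"] that w(1) c by simp
    with w show False by (auto intro!: eq_vecI)
  qed
qed

lemma proj_space_nonempty:
  assumes "Q \<in> proj_space n"
  obtains v where "v \<in> Q" "v \<in> carrier_vec (n + 1)" "v \<noteq> 0\<^sub>v (n + 1)" "Q = proj_point v"
  using assms mem_proj_point_self that unfolding proj_space_def by blast

lemma proj_point_in_space: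
  "v \<in> carrier_vec (n + 1) \<Longrightarrow> v \<noteq> 0\<^sub>v (n + 1) \<Longrightarrow> proj_point v \<in> proj_space n"
  by (auto simp: proj_space_def)

lemma proj_point_in_hyperplane:
  assumes "v \<in> carrier_vec (n + 1)" "v \<noteq> 0\<^sub>v (n + 1)" "h \<in> carrier_vec (n + 1)"
  shows "proj_point v \<in> proj_hyperplane n h \<longleftrightarrow> h \<bullet> v = 0"
proof
  show "proj_point v \<in> proj_hyperplane n h \<Longrightarrow> h \<bullet> v = 0"
    using mem_proj_point_self by (auto simp: proj_hyperplane_def)
  show "h \<bullet> v = 0 \<Longrightarrow> proj_point v \<in> proj_hyperplane n h"
    using assms proj_point_in_space[OF assms(1,2)]
    by (auto simp: proj_hyperplane_def proj_point_def)
qed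

section \<open>Equations and limit points of projective closures\<close>

lemma subset_zariski_closure: "S \<subseteq> carrier_vec n \<Longrightarrow> S \<subseteq> zariski_closure n S"
  by (auto simp: zariski_closure_def)

lemma affine_embed_homogenize: "affine_embed n x = proj_point (homogenize n x)"
  by (simp add: affine_embed_def homogenize_def)

text \<open>Two closures have to be crossed. The dehomogenized form vanishes on \<open>S\<close> and
  therefore on its affine closure; hence the form itself vanishes on the embedded points and on
  their projective closure.\<close>

lemma form_vanishes_on_closure:
  fixes M :: "'i \<Rightarrow> 'a::field"
  assumes "finite I" and f: "\<And>i. i \<in> I \<Longrightarrow> length (f i) = k \<and> set (f i) \<subseteq> {..n}"
    and S: "S \<subseteq> carrier_vec n"
    and van: "\<And>x. x \<in> S \<Longrightarrow> (\<Sum>i\<in>I. M i * prod_list (map (\<lambda>k. homogenize n x $ k) (f i))) = 0"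
    and Q: "Q \<in> proj_closure n (zariski_closure n S)" "v \<in> Q"
  shows "(\<Sum>i\<in>I. M i * prod_list (map (\<lambda>k. v $ k) (f i))) = 0"
proof -
  define p where "p = (\<Sum>i\<in>I. Poly_Mapping.single (mon_of_list (f i)) (M i))"
  \<comment> \<open>Index n evaluates to 1 on \<open>homogenize n x\<close>, so dehomogenizing means
    deleting n from the lists.\<close>
  define p' where "p' = (\<Sum>i\<in>I. Poly_Mapping.single (mon_of_list (filter (\<lambda>k. k < n) (f i))) (M i))"
  have ev: "mpoly_eval p v = (\<Sum>i\<in>I. M i * prod_list (map (\<lambda>k. v $ k) (f i)))" for v
    by (simp add: p_def mpoly_eval_sum mpoly_eval_single mon_eval_of_list)
  have dehom: "prod_list (map (\<lambda>k. x $ k) (filter (\<lambda>k. k < n) ks)) = prod_list (map (\<lambda>k. homogenize n x $ k) ks)"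
    if "set ks \<subseteq> {..n}" for ks and x :: "'a vec"
    using that by (induction ks) (auto simp: homogenize_def)
  have ev': "mpoly_eval p' x = (\<Sum>i\<in>I. M i * prod_list (map (\<lambda>k. homogenize n x $ k) (f i)))" for x
    unfolding p'_def mpoly_eval_sum mpoly_eval_single mon_eval_of_list
    by (intro sum.cong refl arg_cong2[of _ _ _ _ "(*)"] dehom) (use f in auto)
  have "in_vars n p'"
    unfolding in_vars_def p'_def using keys_mon_of_list by (fastforce dest!: keys_sum_single)
  then have U: "mpoly_eval p' x = 0" if "x \<in> zariski_closure n S" for x
    using that van ev' by (auto simp: zariski_closure_def)
  have vars: "in_vars (n + 1) p"
    unfolding in_vars_def p_def using keys_mon_of_list f by (fastforce dest!: keys_sum_single)
  have hom: "mpoly_homogeneous p"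
    unfolding mpoly_homogeneous_def p_def
    by (rule exI[of _ k]) (use f degree_mon_of_list in \<open>auto dest!: keys_sum_single\<close>)
  obtain d where d: "\<And>c v. v \<in> carrier_vec (n + 1) \<Longrightarrow> mpoly_eval p (c \<cdot>\<^sub>v v) = c ^ d * mpoly_eval p v"
    using mpoly_eval_homogeneous[OF vars hom] by blast
  have "mpoly_eval p w = 0" if R: "R \<in> affine_embed n ` zariski_closure n S" "w \<in> R" for R w
  proof -
    from R obtain x c where "x \<in> zariski_closure n S" "w = c \<cdot>\<^sub>v homogenize n x"
      by (auto simp: affine_embed_homogenize proj_point_def)
    moreover have "mpoly_eval p (homogenize n x) = mpoly_eval p' x" by (simp add: ev ev')
    ultimately show ?thesis using U d[OF homogenize_carrier(1)] by simp
  qed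
  then have "mpoly_eval p v = 0"
    using Q vars hom unfolding proj_closure_def proj_zariski_closure_def by blast
  with ev show ?thesis by simp
qed

text \<open>Relations on the curve are phrased through scalar products with fixed vectors. Expanding
  these into coordinates gives index lists of length 1 here and of length 2 in the quadratic
  case.\<close>

lemma linear_form_vanishes_on_closure:
  fixes h :: "'r \<Rightarrow> 'a::field vec" and c :: "'r \<Rightarrow> 'a"
  assumes "S \<subseteq> carrier_vec n" "finite R"
    and "\<And>x. x \<in> S \<Longrightarrow> (\<Sum>r\<in>R. c r * (h r \<bullet> homogenize n x)) = 0"
    and "Q \<in> proj_closure n (zariski_closure n S)" "v \<in> Q"
  shows "(\<Sum>r\<in>R. c r * (h r \<bullet> v)) = 0"
proof -
  have v: "v \<in> carrier_vec (n + 1)"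
    using assms(4,5) proj_space_mem(1) by (auto simp: proj_closure_def proj_zariski_closure_def)
  let ?I = "R \<times> {..n}"
  let ?M = "\<lambda>(r, i). c r * h r $ i"
  let ?f = "\<lambda>(r, i). [i]"
  have sp: "(\<Sum>r\<in>R. c r * (h r \<bullet> w)) = (\<Sum>i\<in>?I. ?M i * prod_list (map (\<lambda>k. w $ k) (?f i)))"
    if "w \<in> carrier_vec (n + 1)" for w
  proof -
    have "g \<bullet> w = (\<Sum>i\<le>n. g $ i * w $ i)" for g :: "'a vec"
      using that unfolding scalar_prod_def by (intro sum.cong) auto
    then show ?thesis
      by (simp add: sum_distrib_left sum.cartesian_product' ac_simps)
  qed
  show ?thesis
    unfolding sp[OF v]
    by (rule form_vanishes_on_closure[where k = 1, OF _ _ assms(1) _ assms(4,5)])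
      (use assms(2,3) sp[OF homogenize_carrier(1)] in auto)
qed

lemma quadratic_form_vanishes_on_closure:
  fixes g h :: "'r \<Rightarrow> 'a::field vec" and c :: "'r \<Rightarrow> 'a"
  assumes "S \<subseteq> carrier_vec n" "finite R"
    and "\<And>x. x \<in> S \<Longrightarrow> (\<Sum>r\<in>R. c r * ((g r \<bullet> homogenize n x) * (h r \<bullet> homogenize n x))) = 0"
    and "Q \<in> proj_closure n (zariski_closure n S)" "v \<in> Q"
  shows "(\<Sum>r\<in>R. c r * ((g r \<bullet> v) * (h r \<bullet> v))) = 0"
proof -
  have v: "v \<in> carrier_vec (n + 1)"
    using assms(4,5) proj_space_mem(1) by (auto simp: proj_closure_def proj_zariski_closure_def)
  let ?I = "R \<times> {..n} \<times> {..n}"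
  let ?M = "\<lambda>(r, i, j). c r * (g r $ i * h r $ j)"
  let ?f = "\<lambda>(r, i, j). [i, j]"
  have sp: "(\<Sum>r\<in>R. c r * ((g r \<bullet> w) * (h r \<bullet> w)))
      = (\<Sum>i\<in>?I. ?M i * prod_list (map (\<lambda>k. w $ k) (?f i)))"
    if "w \<in> carrier_vec (n + 1)" for w
  proof -
    have lin: "g \<bullet> w = (\<Sum>i\<le>n. g $ i * w $ i)" for g :: "'a vec"
      using that unfolding scalar_prod_def by (intro sum.cong) auto
    have "(g \<bullet> w) * (h \<bullet> w) = (\<Sum>i\<le>n. \<Sum>j\<le>n. (g $ i * h $ j) * (w $ i * w $ j))" for g h :: "'a vec"
      unfolding lin sum_product by (simp only: ac_simps)
    then show ?thesis
      by (simp add: sum_distrib_left sum.cartesian_product' mult.assoc)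
  qed
  show ?thesis
    unfolding sp[OF v]
    by (rule form_vanishes_on_closure[where k = 2, OF _ _ assms(1) _ assms(4,5)])
      (use assms(2,3) sp[OF homogenize_carrier(1)] in auto)
qed

text \<open>A form vanishing on \<open>U\<close> restricts along \<open>w\<close> to a polynomial in
  t that is zero on the infinite set \<open>T\<close>, hence zero. So it vanishes at
  \<open>t0\<close> as well, where the affine parametrization may be undefined.\<close>

lemma limit_point_in_proj_closure:
  fixes w :: "nat \<Rightarrow> 'a::field_char_0 poly"
  assumes "infinite T"
    and T: "\<And>t. t \<in> T \<Longrightarrow> \<exists>x\<in>U. \<exists>c. vec (n + 1) (\<lambda>i. poly (w i) t) = c \<cdot>\<^sub>v homogenize n x"
    and nz: "vec (n + 1) (\<lambda>i. poly (w i) t0) \<noteq> 0\<^sub>v (n + 1)"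
  shows "proj_point (vec (n + 1) (\<lambda>i. poly (w i) t0)) \<in> proj_closure n U"
proof -
  let ?w = "\<lambda>t. vec (n + 1) (\<lambda>i. poly (w i) t)"
  have "mpoly_eval p v = 0"
    if p: "in_vars (n + 1) p" "mpoly_homogeneous p" "\<forall>R\<in>affine_embed n ` U. \<forall>v\<in>R. mpoly_eval p v = 0"
      and v: "v \<in> proj_point (?w t0)" for p v
  proof -
    obtain d where d: "\<And>c v. v \<in> carrier_vec (n + 1) \<Longrightarrow> mpoly_eval p (c \<cdot>\<^sub>v v) = c ^ d * mpoly_eval p v"
      using mpoly_eval_homogeneous[OF p(1,2)] by blast
    obtain q where q: "\<And>t. poly q t = mpoly_eval p (?w t)"
      using mpoly_eval_poly[OF p(1)] by metis
    have "poly q t = 0" if "t \<in> T" for t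
    proof -
      from T[OF that] obtain x c where xc: "x \<in> U" "?w t = c \<cdot>\<^sub>v homogenize n x" by blast
      have "mpoly_eval p (homogenize n x) = 0"
        using p(3) xc(1) mem_proj_point_self by (auto simp: affine_embed_homogenize)
      then show ?thesis unfolding q xc(2) d[OF homogenize_carrier(1)] by simp
    qed
    then have "q = 0"
      using assms(1) poly_roots_finite[of q] finite_subset[of T "{t. poly q t = 0}"] by auto
    then have "mpoly_eval p (?w t0) = 0" using q[of t0] by simp
    moreover obtain c where "v = c \<cdot>\<^sub>v ?w t0" using v by (auto simp: proj_point_def)
    ultimately show ?thesis by (simp add: d)
  qed
  then show ?thesis
    unfolding proj_closure_def proj_zariski_closure_def
    using nz proj_point_in_space[of "?w t0" n] by auto
qed

section \<open>Lagrange interpolation at the conjugates\<close>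

text \<open>The linear form Y_j is the scalar product with this vector for \<open>x\<close> the j-th
  conjugate. The last entry is 0 because Y_j does not involve the homogenizing coordinate.\<close>

definition power_vec :: "nat \<Rightarrow> 'a::field \<Rightarrow> 'a vec" where
  "power_vec n x = vec (n + 1) (\<lambda>i. if i < n then x ^ i else 0)"

lemma power_vec_carrier [simp]: "power_vec n x \<in> carrier_vec (Suc n)"
  by (simp add: power_vec_def)

lemma conj_hyperplane_power_vec: "conj_hyperplane n x = proj_hyperplane n (power_vec n x)"
  by (simp add: conj_hyperplane_def power_vec_def)

lemma power_vec_scalar_prod:
  assumes "v \<in> carrier_vec (n + 1)"
  shows "power_vec n x \<bullet> v = (\<Sum>i<n. x ^ i * v $ i)"
  using assms by (simp add: scalar_prod_def power_vec_def atLeast0LessThan)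

definition lagrange :: "nat \<Rightarrow> (nat \<Rightarrow> 'a::field) \<Rightarrow> nat \<Rightarrow> 'a poly" where
  "lagrange n \<beta> j = (\<Prod>k\<in>{1..n} - {j}. smult (1 / (\<beta> j - \<beta> k)) [:- \<beta> k, 1:])"

text \<open>Inverts the Vandermonde matrix of the nodes \<open>\<beta> 1, \<dots>, \<beta> n\<close>; the last entry is the homogenizing
  coordinate.\<close>

definition from_coords :: "nat \<Rightarrow> (nat \<Rightarrow> 'a::field) \<Rightarrow> (nat \<Rightarrow> 'a) \<Rightarrow> 'a \<Rightarrow> 'a vec" where
  "from_coords n \<beta> y z =
     vec (n + 1) (\<lambda>i. if i < n then \<Sum>j\<in>{1..n}. y j * coeff (lagrange n \<beta> j) i else z)"

definition lagrange_point :: "nat \<Rightarrow> (nat \<Rightarrow> 'a::field) \<Rightarrow> nat \<Rightarrow> 'a vec set" where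
  "lagrange_point n \<beta> j = proj_point (from_coords n \<beta> (\<lambda>k. if k = j then 1 else 0) 0)"

lemma from_coords_carrier [simp]: "from_coords n \<beta> y z \<in> carrier_vec (Suc n)"
  by (simp add: from_coords_def)

lemma from_coords_last [simp]: "from_coords n \<beta> y z $ n = z"
  by (simp add: from_coords_def)

lemma hyperplane_at_infinity_iff:
  "Q \<in> hyperplane_at_infinity n \<longleftrightarrow> Q \<in> proj_space n \<and> (\<forall>v\<in>Q. v $ n = 0)"
proof -
  have "unit_vec (n + 1) n \<bullet> v = v $ n" if "Q \<in> proj_space n" "v \<in> Q" for v
    using proj_space_mem(1)[OF that] by (simp add: scalar_prod_left_unit)
  then show ?thesis by (auto simp: hyperplane_at_infinity_def proj_hyperplane_def)
qed

lemma proj_closure_space: "proj_closure n U \<subseteq> proj_space n"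
  by (auto simp: proj_closure_def proj_zariski_closure_def)

locale interpolation =
  fixes n :: nat and \<beta> :: "nat \<Rightarrow> 'a::field_char_0"
  assumes inj: "inj_on \<beta> {1..n}"
begin

lemma poly_lagrange:
  assumes "j \<in> {1..n}" "k \<in> {1..n}"
  shows "poly (lagrange n \<beta> j) (\<beta> k) = (if k = j then 1 else 0)"
proof (cases "k = j")
  case True
  have "poly (smult (1 / (\<beta> j - \<beta> l)) [:- \<beta> l, 1:]) (\<beta> j) = 1" if "l \<in> {1..n} - {j}" for l
  proof -
    have "\<beta> j - \<beta> l \<noteq> 0" using inj_onD[OF inj, of j l] assms that by auto
    then show ?thesis by (simp add: diff_divide_distrib[symmetric])
  qed
  then have "(\<Prod>l\<in>{1..n} - {j}. poly (smult (1 / (\<beta> j - \<beta> l)) [:- \<beta> l, 1:]) (\<beta> j)) = 1"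
    by (intro prod.neutral) blast
  then show ?thesis using True by (simp only: lagrange_def poly_prod if_True refl)
next
  case False
  then have "k \<in> {1..n} - {j}" using assms by simp
  moreover have "poly (smult (1 / (\<beta> j - \<beta> k)) [:- \<beta> k, 1:]) (\<beta> k) = 0" by simp
  ultimately have "(\<Prod>l\<in>{1..n} - {j}. poly (smult (1 / (\<beta> j - \<beta> l)) [:- \<beta> l, 1:]) (\<beta> k)) = 0"
    by (intro prod_zero) blast+
  then show ?thesis using False by (simp only: lagrange_def poly_prod if_False)
qed

lemma degree_lagrange:
  assumes "j \<in> {1..n}"
  shows "degree (lagrange n \<beta> j) < n"
proof -
  have "degree (lagrange n \<beta> j) \<le> (\<Sum>k\<in>{1..n} - {j}. 1)"
    unfolding lagrange_def
    by (rule order_trans[OF degree_prod_sum_le]) (simp, intro sum_mono order_trans[OF degree_smult_le], simp)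
  also have "\<dots> < n" using assms by simp
  finally show ?thesis .
qed

text \<open>The first n entries of \<open>from_coords\<close> are the coefficients of the polynomial
  interpolating the values \<open>y\<close>, and the scalar product with \<open>power_vec\<close>
  evaluates it at a node.\<close>

lemma power_vec_from_coords:
  assumes "k \<in> {1..n}"
  shows "power_vec n (\<beta> k) \<bullet> from_coords n \<beta> y z = y k"
proof -
  have "power_vec n (\<beta> k) \<bullet> from_coords n \<beta> y z
      = (\<Sum>i<n. \<beta> k ^ i * (\<Sum>j\<in>{1..n}. y j * coeff (lagrange n \<beta> j) i))"
    by (simp add: power_vec_scalar_prod from_coords_def)
  also have "\<dots> = (\<Sum>j\<in>{1..n}. y j * (\<Sum>i<n. coeff (lagrange n \<beta> j) i * \<beta> k ^ i))"
    unfolding sum_distrib_left by (subst sum.swap) (simp add: ac_simps)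
  also have "\<dots> = (\<Sum>j\<in>{1..n}. y j * poly (lagrange n \<beta> j) (\<beta> k))"
  proof (intro sum.cong refl arg_cong2[of _ _ _ _ "(*)"])
    fix j assume "j \<in> {1..n}"
    from degree_lagrange[OF this]
    show "(\<Sum>i<n. coeff (lagrange n \<beta> j) i * \<beta> k ^ i) = poly (lagrange n \<beta> j) (\<beta> k)"
      unfolding poly_altdef by (intro sum.mono_neutral_right) (auto simp: coeff_eq_0)
  qed
  also have "\<dots> = (\<Sum>j\<in>{1..n}. if j = k then y j else 0)"
    using assms by (intro sum.cong) (auto simp: poly_lagrange)
  finally show ?thesis using assms by simp
qed

text \<open>The differences of the first n entries are the coefficients of a polynomial of degree
  below n that vanishes at n distinct nodes.\<close>

lemma coords_eqI:
  assumes "v \<in> carrier_vec (n + 1)" "w \<in> carrier_vec (n + 1)" "v $ n = w $ n"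
    and "\<And>k. k \<in> {1..n} \<Longrightarrow> power_vec n (\<beta> k) \<bullet> v = power_vec n (\<beta> k) \<bullet> w"
  shows "v = w"
proof -
  define p where "p = (\<Sum>i<n. monom (v $ i - w $ i) i)"
  have root: "poly p (\<beta> k) = 0" if "k \<in> {1..n}" for k
    using assms(4)[OF that] assms(1,2)
    by (simp add: p_def poly_sum poly_monom power_vec_scalar_prod algebra_simps sum_subtractf)
  have coeff: "coeff p i = v $ i - w $ i" if "i < n" for i
    using that by (simp add: p_def coeff_sum)
  have "p = 0"
  proof (rule ccontr)
    assume "p \<noteq> 0"
    then have "n > 0" by (cases n) (auto simp: p_def)
    have "n = card (\<beta> ` {1..n})" using inj by (simp add: card_image)
    also have "\<dots> \<le> card {x. poly p x = 0}"
      using root \<open>p \<noteq> 0\<close> by (intro card_mono poly_roots_finite) auto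
    also have "\<dots> \<le> degree p" by (rule card_poly_roots_bound[OF \<open>p \<noteq> 0\<close>])
    also have "\<dots> < n"
    proof -
      have "degree p \<le> n - 1"
        unfolding p_def by (rule degree_sum_le) (auto intro: order_trans[OF degree_monom_le])
      with \<open>n > 0\<close> show ?thesis by linarith
    qed
    finally show False by simp
  qed
  show ?thesis
  proof (rule eq_vecI)
    fix i assume "i < dim_vec w"
    then show "v $ i = w $ i"
      using assms(2,3) coeff[of i] \<open>p = 0\<close> by (cases "i = n") auto
  qed (use assms in auto)
qed

lemma from_coords_power_vec:
  assumes "v \<in> carrier_vec (n + 1)"
  shows "from_coords n \<beta> (\<lambda>k. power_vec n (\<beta> k) \<bullet> v) (v $ n) = v"
  by (rule coords_eqI) (use assms in \<open>auto simp: power_vec_from_coords\<close>)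

lemma from_coords_cong:
  "(\<And>k. k \<in> {1..n} \<Longrightarrow> y k = y' k) \<Longrightarrow> from_coords n \<beta> y z = from_coords n \<beta> y' z"
  unfolding from_coords_def by (intro eq_vecI) auto

lemma from_coords_smult: "c \<cdot>\<^sub>v from_coords n \<beta> y z = from_coords n \<beta> (\<lambda>k. c * y k) (c * z)"
  by (intro eq_vecI) (auto simp: from_coords_def sum_distrib_left ac_simps)

lemma from_coords_nonzero:
  assumes "z \<noteq> 0 \<or> (\<exists>k\<in>{1..n}. y k \<noteq> 0)"
  shows "from_coords n \<beta> y z \<noteq> 0\<^sub>v (n + 1)"
proof
  assume *: "from_coords n \<beta> y z = 0\<^sub>v (n + 1)"
  have "z = 0" using arg_cong[OF *, of "\<lambda>v. v $ n"] by simp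
  moreover have "y k = 0" if "k \<in> {1..n}" for k
    unfolding power_vec_from_coords[OF that, of y z, symmetric] *
    by (simp add: power_vec_scalar_prod)
  ultimately show False using assms by auto
qed

lemma lagrange_point_at_infinity:
  assumes "j \<in> {1..n}"
  shows "lagrange_point n \<beta> j \<in> hyperplane_at_infinity n"
proof -
  let ?e = "from_coords n \<beta> (\<lambda>k. if k = j then 1 else 0) 0"
  have nz: "?e \<noteq> 0\<^sub>v (n + 1)" using assms by (intro from_coords_nonzero) auto
  have "unit_vec (n + 1) n \<bullet> ?e = 0" by simp
  with nz show ?thesis
    unfolding hyperplane_at_infinity_def lagrange_point_def
    by (subst proj_point_in_hyperplane) auto
qed

lemma lagrange_point_conj_hyperplane:
  assumes "j \<in> {1..n}" "k \<in> {1..n}"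
  shows "lagrange_point n \<beta> j \<in> conj_hyperplane n (\<beta> k) \<longleftrightarrow> k \<noteq> j"
proof -
  have "from_coords n \<beta> (\<lambda>k. if k = j then 1 else 0) 0 \<noteq> 0\<^sub>v (n + 1)"
    using assms by (intro from_coords_nonzero) auto
  then show ?thesis
    using assms unfolding conj_hyperplane_power_vec lagrange_point_def
    by (subst proj_point_in_hyperplane) (auto simp: power_vec_from_coords)
qed

text \<open>With the last coordinate and every Y_k for k ~= j equal to zero, a representative is a
  multiple of the j-th coordinate vector, and the factor is nonzero because the representative
  is.\<close>

lemma lagrange_point_unique:
  assumes "Q \<in> hyperplane_at_infinity n" "j \<in> {1..n}"
    and "\<And>k. k \<in> {1..n} \<Longrightarrow> k \<noteq> j \<Longrightarrow> Q \<in> conj_hyperplane n (\<beta> k)"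
  shows "Q = lagrange_point n \<beta> j"
proof -
  have Q: "Q \<in> proj_space n" using assms(1) by (simp add: hyperplane_at_infinity_iff)
  then obtain v where v: "v \<in> Q" "v \<in> carrier_vec (n + 1)" "v \<noteq> 0\<^sub>v (n + 1)" "Q = proj_point v"
    by (rule proj_space_nonempty)
  have last: "v $ n = 0" using assms(1) v(1) by (simp add: hyperplane_at_infinity_iff)
  define c where "c = power_vec n (\<beta> j) \<bullet> v"
  have y: "power_vec n (\<beta> k) \<bullet> v = c * (if k = j then 1 else 0)" if "k \<in> {1..n}" for k
    using assms(3)[OF that] v(1) by (auto simp: conj_hyperplane_power_vec proj_hyperplane_def c_def)
  have "from_coords n \<beta> (\<lambda>k. power_vec n (\<beta> k) \<bullet> v) (v $ n)
      = from_coords n \<beta> (\<lambda>k. c * (if k = j then 1 else 0)) (c * 0)"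
    unfolding last mult_zero_right by (rule from_coords_cong) (rule y)
  then have eq: "v = c \<cdot>\<^sub>v from_coords n \<beta> (\<lambda>k. if k = j then 1 else 0) 0"
    unfolding from_coords_power_vec[OF v(2)] from_coords_smult .
  have "c \<noteq> 0"
  proof
    assume 0: "c = 0"
    have "v = 0\<^sub>v (n + 1)"
      by (subst eq, unfold 0) (auto intro!: eq_vecI simp: from_coords_def)
    with v(3) show False by simp
  qed
  then show ?thesis
    unfolding v(4) lagrange_point_def by (subst eq) (rule proj_point_smult)
qed

lemma inj_on_lagrange_point: "inj_on (lagrange_point n \<beta>) {1..n}"
  by (rule inj_onI) (metis lagrange_point_conj_hyperplane)

text \<open>Rewrites an arbitrary hyperplane in the coordinates Y_k, in which the parametrization is
  explicit.\<close>

lemma scalar_prod_from_coords: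
  obtains g where "\<And>y z. h \<bullet> from_coords n \<beta> y z = (\<Sum>k\<in>{1..n}. g k * y k) + h $ n * z"
proof
  fix y z
  have "h \<bullet> from_coords n \<beta> y z
      = (\<Sum>i<n. \<Sum>k\<in>{1..n}. h $ i * coeff (lagrange n \<beta> k) i * y k) + h $ n * z"
    by (simp add: scalar_prod_def from_coords_def atLeast0LessThan sum_distrib_left ac_simps)
  also have "\<dots> = (\<Sum>k\<in>{1..n}. (\<Sum>i<n. h $ i * coeff (lagrange n \<beta> k) i) * y k) + h $ n * z"
    by (subst sum.swap) (simp add: sum_distrib_right)
  finally show "h \<bullet> from_coords n \<beta> y z
      = (\<Sum>k\<in>{1..n}. (\<Sum>i<n. h $ i * coeff (lagrange n \<beta> k) i) * y k) + h $ n * z" .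
qed

end

section \<open>Curves parametrized by Moebius transformations\<close>

text \<open>Multiplying by all denominators turns the function into a polynomial of degree at most
  \<open>card J\<close>; the value at \<open>t0\<close> certifies that this polynomial is not
  zero.\<close>

lemma few_zeros:
  fixes A B C D g :: "nat \<Rightarrow> 'a::field_char_0"
  assumes "finite J" "\<And>k. k \<in> J \<Longrightarrow> C k * t0 + D k \<noteq> 0"
    and "(\<Sum>k\<in>J. g k * ((A k * t0 + B k) / (C k * t0 + D k))) + \<mu> \<noteq> 0"
  defines "Z \<equiv> {t. (\<forall>k\<in>J. C k * t + D k \<noteq> 0) \<and>
      (\<Sum>k\<in>J. g k * ((A k * t + B k) / (C k * t + D k))) + \<mu> = 0}"
  shows "finite Z" "card Z \<le> card J"
proof -
  define p where "p = (\<Sum>k\<in>J. smult (g k) ([:B k, A k:] * (\<Prod>l\<in>J - {k}. [:D l, C l:])))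
      + smult \<mu> (\<Prod>l\<in>J. [:D l, C l:])"
  have eval: "poly p t = ((\<Sum>k\<in>J. g k * ((A k * t + B k) / (C k * t + D k))) + \<mu>) * (\<Prod>l\<in>J. C l * t + D l)"
    if t: "\<forall>k\<in>J. C k * t + D k \<noteq> 0" for t
  proof -
    have "g k * ((A k * t + B k) * (\<Prod>l\<in>J - {k}. C l * t + D l))
        = g k * ((A k * t + B k) / (C k * t + D k)) * (\<Prod>l\<in>J. C l * t + D l)" if "k \<in> J" for k
      using t that by (simp add: prod.remove[OF assms(1) that])
    note term_eq = this
    have "poly p t = (\<Sum>k\<in>J. g k * ((A k * t + B k) * (\<Prod>l\<in>J - {k}. C l * t + D l)))
        + \<mu> * (\<Prod>l\<in>J. C l * t + D l)"
      by (simp add: p_def poly_sum poly_prod algebra_simps)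
    also have "(\<Sum>k\<in>J. g k * ((A k * t + B k) * (\<Prod>l\<in>J - {k}. C l * t + D l)))
        = (\<Sum>k\<in>J. g k * ((A k * t + B k) / (C k * t + D k)) * (\<Prod>l\<in>J. C l * t + D l))"
      by (rule sum.cong[OF refl term_eq])
    finally show ?thesis
      by (simp only: distrib_right sum_distrib_right)
  qed
  have "poly p t0 \<noteq> 0"
    using assms(1-3) by (subst eval) auto
  then have p0: "p \<noteq> 0" by auto
  have lin: "degree [:x, y:] \<le> 1" for x y :: 'a by simp
  have prod_deg: "degree (\<Prod>l\<in>K. [:D l, C l:]) \<le> card K" if "finite K" for K
  proof -
    have "degree (\<Prod>l\<in>K. [:D l, C l:]) \<le> (\<Sum>l\<in>K. degree [:D l, C l:])"
      using degree_prod_sum_le[OF that, of "\<lambda>l. [:D l, C l:]"] by (simp only: o_def)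
    also have "\<dots> \<le> (\<Sum>l\<in>K. 1)" by (intro sum_mono lin)
    finally show ?thesis by simp
  qed
  have "degree (smult (g k) ([:B k, A k:] * (\<Prod>l\<in>J - {k}. [:D l, C l:]))) \<le> card J" if "k \<in> J" for k
  proof -
    have "degree ([:B k, A k:] * (\<Prod>l\<in>J - {k}. [:D l, C l:])) \<le> 1 + card (J - {k})"
      by (rule order_trans[OF degree_mult_le add_mono[OF lin prod_deg]]) (use assms(1) in auto)
    also have "\<dots> = card J" using card_Suc_Diff1[OF assms(1) that] by simp
    finally show ?thesis using degree_smult_le order_trans by blast
  qed
  then have deg: "degree p \<le> card J"
    unfolding p_def
    by (intro degree_add_le degree_sum_le assms(1) order_trans[OF degree_smult_le prod_deg])
  have sub: "Z \<subseteq> {t. poly p t = 0}" by (auto simp: Z_def eval)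
  then show "finite Z" using poly_roots_finite[OF p0] finite_subset by blast
  have "card Z \<le> card {t. poly p t = 0}" using sub poly_roots_finite[OF p0] by (rule card_mono[rotated])
  also have "\<dots> \<le> degree p" by (rule card_poly_roots_bound[OF p0])
  finally show "card Z \<le> card J" using deg by simp
qed

text \<open>Ties a point to a finite parameter at which no transformation has its pole. The
  remaining parameters, t = infinity and the poles, have to be handled separately.\<close>

definition moebius_coords ::
    "nat \<Rightarrow> (nat \<Rightarrow> 'a::field) \<Rightarrow> (nat \<Rightarrow> 'a) \<Rightarrow> (nat \<Rightarrow> 'a) \<Rightarrow> (nat \<Rightarrow> 'a) \<Rightarrow> (nat \<Rightarrow> 'a) \<Rightarrow> 'a vec \<Rightarrow> 'a \<Rightarrow> bool" where
  "moebius_coords n \<beta> A B C D x t \<longleftrightarrow> (\<forall>k\<in>{1..n}. C k * t + D k \<noteq> 0 \<and>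
     power_vec n (\<beta> k) \<bullet> homogenize n x = (A k * t + B k) / (C k * t + D k))"

lemma homogenize_last [simp]: "homogenize n x $ n = 1"
  by (simp add: homogenize_def)

context interpolation
begin

lemma homogenize_from_coords:
  assumes "moebius_coords n \<beta> A B C D x t"
  shows "homogenize n x = from_coords n \<beta> (\<lambda>k. (A k * t + B k) / (C k * t + D k)) 1"
  by (rule coords_eqI)
    (use assms in \<open>auto simp: moebius_coords_def power_vec_from_coords\<close>)

text \<open>As \<open>t\<close> tends to the pole of the \<open>j\<close>-th transformation, only the \<open>j\<close>-th coordinate blows up.\<close>

lemma lagrange_point_in_closure_aux:
  assumes det: "\<And>k. k \<in> {1..n} \<Longrightarrow> A k * D k - B k * C k \<noteq> 0"
    and inf: "infinite {t. \<exists>x\<in>U. moebius_coords n \<beta> A B C D x t}"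
    and j: "j \<in> {1..n}" "C j \<noteq> 0"
    and poles: "\<And>k. k \<in> {1..n} \<Longrightarrow> k \<noteq> j \<Longrightarrow> C k * D j \<noteq> D k * C j"
  shows "lagrange_point n \<beta> j \<in> proj_closure n U"
proof -
  \<comment> \<open>Clearing the common denominator \<open>r\<close> gives polynomial homogeneous
    coordinates that still make sense at a pole. The factor of the j-th pole occurs in
    \<open>r\<close> and in every \<open>q k\<close> except \<open>q j\<close>.\<close>
  define q where "q k = [:B k, A k:] * (\<Prod>l\<in>{1..n} - {k}. [:D l, C l:])" for k
  define r where "r = (\<Prod>l\<in>{1..n}. [:D l, C l:])"
  define w where "w i = (if i < n then \<Sum>k\<in>{1..n}. smult (coeff (lagrange n \<beta> k) i) (q k) else r)" for i
  have w: "vec (n + 1) (\<lambda>i. poly (w i) t) = from_coords n \<beta> (\<lambda>k. poly (q k) t) (poly r t)" for t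
    unfolding from_coords_def by (rule eq_vecI) (auto simp: w_def poly_sum ac_simps)
  define t0 where "t0 = - D j / C j"
  have pole: "C k * t0 + D k = 0 \<longleftrightarrow> C k * D j = D k * C j" for k
    using j(2) by (auto simp: t0_def field_simps)
  have r0: "poly r t0 = 0"
    unfolding r_def poly_prod by (rule prod_zero) (use j pole[of j] in \<open>auto simp: ac_simps intro!: bexI[of _ j]\<close>)
  have q0: "poly (q k) t0 = 0" if "k \<in> {1..n}" "k \<noteq> j" for k
  proof -
    have "poly (\<Prod>l\<in>{1..n} - {k}. [:D l, C l:]) t0 = 0"
      unfolding poly_prod by (rule prod_zero) (use j that pole[of j] in \<open>auto simp: ac_simps intro!: bexI[of _ j]\<close>)
    then show ?thesis by (simp add: q_def)
  qed
  have qj: "poly (q j) t0 \<noteq> 0"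
  proof -
    have "A j * t0 + B j \<noteq> 0"
      using det[OF j(1)] j(2) by (auto simp: t0_def field_simps)
    moreover have "poly (\<Prod>l\<in>{1..n} - {j}. [:D l, C l:]) t0 \<noteq> 0"
      unfolding poly_prod using pole poles by (auto simp: ac_simps)
    moreover have "poly (q j) t0 = (A j * t0 + B j) * poly (\<Prod>l\<in>{1..n} - {j}. [:D l, C l:]) t0"
      by (simp add: q_def algebra_simps)
    ultimately show ?thesis by simp
  qed
  let ?e = "from_coords n \<beta> (\<lambda>k. if k = j then 1 else 0) 0"
  have lim: "vec (n + 1) (\<lambda>i. poly (w i) t0) = poly (q j) t0 \<cdot>\<^sub>v ?e"
    unfolding w from_coords_smult r0 mult_zero_right
    by (rule from_coords_cong) (use q0 in auto)
  have "proj_point (vec (n + 1) (\<lambda>i. poly (w i) t0)) \<in> proj_closure n U"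
  proof (rule limit_point_in_proj_closure[OF inf])
    fix t assume "t \<in> {t. \<exists>x\<in>U. moebius_coords n \<beta> A B C D x t}"
    then obtain x where x: "x \<in> U" "moebius_coords n \<beta> A B C D x t" by blast
    have "poly (q k) t = poly r t * ((A k * t + B k) / (C k * t + D k))" if k: "k \<in> {1..n}" for k
    proof -
      have "C k * t + D k \<noteq> 0" using x(2) k by (simp add: moebius_coords_def)
      moreover have "poly (q k) t = (A k * t + B k) * (\<Prod>l\<in>{1..n} - {k}. C l * t + D l)"
        by (simp add: q_def poly_prod algebra_simps)
      moreover have "poly r t = (C k * t + D k) * (\<Prod>l\<in>{1..n} - {k}. C l * t + D l)"
        using prod.remove[OF _ k, of "\<lambda>l. C l * t + D l"] by (simp add: r_def poly_prod ac_simps)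
      ultimately show ?thesis by simp
    qed
    then have "from_coords n \<beta> (\<lambda>k. poly (q k) t) (poly r t) = poly r t \<cdot>\<^sub>v homogenize n x"
      unfolding homogenize_from_coords[OF x(2)] from_coords_smult mult_1_right
      by (rule from_coords_cong)
    with x(1) show "\<exists>x\<in>U. \<exists>c. vec (n + 1) (\<lambda>i. poly (w i) t) = c \<cdot>\<^sub>v homogenize n x"
      unfolding w by blast
  next
    show "vec (n + 1) (\<lambda>i. poly (w i) t0) \<noteq> 0\<^sub>v (n + 1)"
      unfolding w by (rule from_coords_nonzero) (use qj j(1) in blast)
  qed
  then show ?thesis
    unfolding lim proj_point_smult[OF qj] lagrange_point_def .
qed

lemma lagrange_point_in_closure:
  assumes det: "\<And>k. k \<in> {1..n} \<Longrightarrow> A k * D k - B k * C k \<noteq> 0"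
    and inf: "infinite {t. \<exists>x\<in>U. moebius_coords n \<beta> A B C D x t}"
    and j: "j \<in> {1..n}"
    and poles: "\<And>k. k \<in> {1..n} \<Longrightarrow> k \<noteq> j \<Longrightarrow> C k * D j \<noteq> D k * C j"
  shows "lagrange_point n \<beta> j \<in> proj_closure n U"
proof (cases "C j = 0")
  case False
  then show ?thesis using assms by (intro lagrange_point_in_closure_aux) auto
next
  case True
  \<comment> \<open>The pole is at infinity; reparametrize by \<open>1 / t\<close>.\<close>
  let ?T = "\<lambda>A B C D. {t. \<exists>x\<in>U. moebius_coords n \<beta> A B C D x t}"
  have "inverse ` (?T A B C D - {0}) \<subseteq> ?T B A D C"
  proof
    fix s assume "s \<in> inverse ` (?T A B C D - {0})"
    then obtain t x where t: "t \<noteq> 0" "s = inverse t" "x \<in> U" "moebius_coords n \<beta> A B C D x t" by auto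
    have "D k * s + C k = (C k * t + D k) / t" "B k * s + A k = (A k * t + B k) / t" for k
      using t(1,2) by (simp_all add: field_simps)
    then have "moebius_coords n \<beta> B A D C x s"
      using t(1,4) by (simp add: moebius_coords_def)
    with t(3) show "s \<in> ?T B A D C" by blast
  qed
  moreover have "infinite (inverse ` (?T A B C D - {0}))"
    using inf by (subst finite_image_iff) (auto simp: inj_on_def)
  ultimately have inf': "infinite (?T B A D C)" using finite_subset by blast
  show ?thesis
  proof (rule lagrange_point_in_closure_aux[OF _ inf' j])
    show "B k * C k - A k * D k \<noteq> 0" if "k \<in> {1..n}" for k
      using det[OF that] by (simp add: algebra_simps)
    show "D j \<noteq> 0" using det[OF j] True by auto
    show "D k * C j \<noteq> C k * D j" if "k \<in> {1..n}" "k \<noteq> j" for k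
      using poles[OF that] by metis
  qed
qed

end

text \<open>Abstracts the hypercircle: index k stands for \<sigma>_k applied to the coefficients of
  u. \<open>S\<close> is the image of the parametrization before any closure is taken.\<close>

locale moebius_curve = interpolation n \<beta> for n :: nat and \<beta> :: "nat \<Rightarrow> 'a::field_char_0" +
  fixes A B C D :: "nat \<Rightarrow> 'a" and S :: "'a vec set"
  assumes det: "\<And>k. k \<in> {1..n} \<Longrightarrow> A k * D k - B k * C k \<noteq> 0"
    and S_carrier: "S \<subseteq> carrier_vec n"
    and param: "\<And>x. x \<in> S \<Longrightarrow> \<exists>t. moebius_coords n \<beta> A B C D x t"
    and infinite_param: "infinite {t. \<exists>x\<in>S. moebius_coords n \<beta> A B C D x t}"
begin

abbreviation "closure_S \<equiv> proj_closure n (zariski_closure n S)"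

abbreviation "Y k v \<equiv> power_vec n (\<beta> k) \<bullet> v"

lemma closure_S_carrier: "Q \<in> closure_S \<Longrightarrow> v \<in> Q \<Longrightarrow> v \<in> carrier_vec (n + 1)"
  using proj_space_mem(1) by (auto simp: proj_closure_def proj_zariski_closure_def)

lemma last_scalar_prod:
  fixes v :: "'a vec"
  shows "v \<in> carrier_vec (n + 1) \<Longrightarrow> unit_vec (n + 1) n \<bullet> v = v $ n"
  by (simp add: scalar_prod_left_unit)

text \<open>Both sides compare the parameter \<open>t = (D y - B) / (A - C y)\<close> computed from the coordinates
  \<open>i\<close> and \<open>j\<close>.\<close>

lemma closure_relation:
  assumes ij: "i \<in> {1..n}" "j \<in> {1..n}" and Q: "Q \<in> closure_S" "v \<in> Q"
  shows "(D i * Y i v - B i * v $ n) * (A j * v $ n - C j * Y j v)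
       = (D j * Y j v - B j * v $ n) * (A i * v $ n - C i * Y i v)"
proof -
  \<comment> \<open>Coefficients of the right side minus the left side at Y_i Y_j, Y_j X_n, Y_i X_n
    and X_n^2, in this order; \<open>g\<close> and \<open>h\<close> list the two factors of each
    monomial.\<close>
  define c where "c = nth [C j * D i - D j * C i, D j * A i - C j * B i, B j * C i - A j * D i, A j * B i - B j * A i]"
  define g where "g = nth [power_vec n (\<beta> i), power_vec n (\<beta> j), power_vec n (\<beta> i), unit_vec (n + 1) n]"
  define h where "h = nth [power_vec n (\<beta> j), unit_vec (n + 1) n, unit_vec (n + 1) n, unit_vec (n + 1) n]"
  have expand: "(\<Sum>r<4. c r * ((g r \<bullet> v) * (h r \<bullet> v)))
      = (D j * Y j v - B j * v $ n) * (A i * v $ n - C i * Y i v)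
      - (D i * Y i v - B i * v $ n) * (A j * v $ n - C j * Y j v)"
    if "v \<in> carrier_vec (n + 1)" for v
    by (simp add: c_def g_def h_def eval_nat_numeral last_scalar_prod[OF that, simplified] algebra_simps)
  have "(\<Sum>r<4. c r * ((g r \<bullet> v) * (h r \<bullet> v))) = 0"
  proof (rule quadratic_form_vanishes_on_closure[OF S_carrier _ _ Q])
    fix x assume "x \<in> S"
    from param[OF this] obtain t where t: "moebius_coords n \<beta> A B C D x t" by blast
    \<comment> \<open>The Moebius relation without denominators. It turns both sides into t times
      the same product.\<close>
    have *: "D k * Y k (homogenize n x) - B k = t * (A k - C k * Y k (homogenize n x))" if "k \<in> {1..n}" for k
    proof -
      have "C k * t + D k \<noteq> 0" "Y k (homogenize n x) * (C k * t + D k) = A k * t + B k"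
        using t that by (auto simp: moebius_coords_def)
      then show ?thesis by (simp add: algebra_simps)
    qed
    show "(\<Sum>r<4. c r * ((g r \<bullet> homogenize n x) * (h r \<bullet> homogenize n x))) = 0"
      unfolding expand[OF homogenize_carrier(1)] homogenize_last mult_1_right *[OF ij(1)] *[OF ij(2)]
      by simp
  qed simp
  then show ?thesis unfolding expand[OF closure_S_carrier[OF Q]] by simp
qed

text \<open>This is the coefficient of Y_j in the linear relation below. If it vanished, the i-th
  determinant would annihilate both \<open>C j\<close> and \<open>D j\<close>, so both would be
  zero, against the j-th determinant.\<close>

lemma same_pole_factor:
  assumes "i \<in> {1..n}" "j \<in> {1..n}" "C j * D i = D j * C i"
  shows "D j * A i - B i * C j \<noteq> 0"
proof
  assume *: "D j * A i - B i * C j = 0"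
  have "D j * (A i * D i - B i * C i) = (D j * A i - B i * C j) * D i + B i * (C j * D i - D j * C i)"
    by (simp add: algebra_simps)
  moreover have "C j * (A i * D i - B i * C i) = A i * (C j * D i - D j * C i) + C i * (D j * A i - B i * C j)"
    by (simp add: algebra_simps)
  ultimately have "D j * (A i * D i - B i * C i) = 0" "C j * (A i * D i - B i * C i) = 0"
    using * assms(3) by simp_all
  then have "D j = 0" "C j = 0" using det[OF assms(1)] by auto
  then show False using det[OF assms(2)] by simp
qed

text \<open>Once the coefficient of Y_i Y_j vanishes, the bilinear relation is X_n times a linear
  one. Dividing is legitimate on the affine points of \<open>S\<close>, where X_n = 1, and the
  linear relation then passes to the closure by itself. It is informative at infinity, where the
  bilinear relation has become 0 = 0.\<close>

lemma closure_relation_same_pole: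
  assumes ij: "i \<in> {1..n}" "j \<in> {1..n}" "C j * D i = D j * C i" and Q: "Q \<in> closure_S" "v \<in> Q"
  shows "(D j * A i - B i * C j) * Y j v = (D i * A j - B j * C i) * Y i v + (B j * A i - B i * A j) * v $ n"
proof -
  define c where "c = nth [D j * A i - B i * C j, B j * C i - D i * A j, B i * A j - B j * A i]"
  define h where "h = nth [power_vec n (\<beta> j), power_vec n (\<beta> i), unit_vec (n + 1) n]"
  have expand: "(\<Sum>r<3. c r * (h r \<bullet> v)) = (D j * A i - B i * C j) * Y j v
      - ((D i * A j - B j * C i) * Y i v + (B j * A i - B i * A j) * v $ n)"
    if "v \<in> carrier_vec (n + 1)" for v
    by (simp add: c_def h_def eval_nat_numeral last_scalar_prod[OF that, simplified] algebra_simps)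
  have "(\<Sum>r<3. c r * (h r \<bullet> v)) = 0"
  proof (rule linear_form_vanishes_on_closure[OF S_carrier _ _ Q])
    fix x assume "x \<in> S"
    from param[OF this] obtain t where t: "moebius_coords n \<beta> A B C D x t" by blast
    have *: "D k * Y k (homogenize n x) - B k = t * (A k - C k * Y k (homogenize n x))" if "k \<in> {1..n}" for k
    proof -
      have "C k * t + D k \<noteq> 0" "Y k (homogenize n x) * (C k * t + D k) = A k * t + B k"
        using t that by (auto simp: moebius_coords_def)
      then show ?thesis by (simp add: algebra_simps)
    qed
    show "(\<Sum>r<3. c r * (h r \<bullet> homogenize n x)) = 0"
      unfolding expand[OF homogenize_carrier(1)] homogenize_last mult_1_right
    proof -
      let ?y = "\<lambda>k. Y k (homogenize n x)"
      have "(D j * A i - B i * C j) * ?y j - ((D i * A j - B j * C i) * ?y i + (B j * A i - B i * A j))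
          = (D j * ?y j - B j) * (A i - C i * ?y i) - (D i * ?y i - B i) * (A j - C j * ?y j)
            - ?y i * ?y j * (C j * D i - D j * C i)"
        by (simp add: algebra_simps)
      also have "\<dots> = 0" unfolding *[OF ij(1)] *[OF ij(2)] ij(3) by simp
      finally show "(D j * A i - B i * C j) * ?y j
          - ((D i * A j - B j * C i) * ?y i + (B j * A i - B i * A j)) = 0" .
    qed
  qed simp
  then show ?thesis unfolding expand[OF closure_S_carrier[OF Q]] by simp
qed

lemma closure_at_infinity:
  assumes poles: "\<And>i j. i \<in> {1..n} \<Longrightarrow> j \<in> {1..n} \<Longrightarrow> i \<noteq> j \<Longrightarrow> C j * D i \<noteq> D j * C i"
  shows "closure_S \<inter> hyperplane_at_infinity n = lagrange_point n \<beta> ` {1..n}"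
proof
  show "closure_S \<inter> hyperplane_at_infinity n \<subseteq> lagrange_point n \<beta> ` {1..n}"
  proof
    fix Q assume Q: "Q \<in> closure_S \<inter> hyperplane_at_infinity n"
    then have Q': "Q \<in> proj_space n" by (simp add: hyperplane_at_infinity_iff)
    then obtain v where v: "v \<in> Q" "v \<in> carrier_vec (n + 1)" "v \<noteq> 0\<^sub>v (n + 1)" "Q = proj_point v"
      by (rule proj_space_nonempty)
    have last: "v $ n = 0" using Q v(1) by (simp add: hyperplane_at_infinity_iff)
    have "\<exists>j\<in>{1..n}. Y j v \<noteq> 0"
    proof (rule ccontr)
      assume "\<not> ?thesis"
      then have "v = 0\<^sub>v (n + 1)"
        using v(2) last by (intro coords_eqI) (auto simp: power_vec_scalar_prod)
      with v(3) show False by simp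
    qed
    then obtain j where j: "j \<in> {1..n}" "Y j v \<noteq> 0" by blast
    have "Q = lagrange_point n \<beta> j"
    proof (rule lagrange_point_unique[OF _ j(1)])
      show "Q \<in> hyperplane_at_infinity n" using Q by simp
      fix k assume k: "k \<in> {1..n}" "k \<noteq> j"
      have "(C j * D k - D j * C k) * Y j v * Y k v = 0"
        using closure_relation[OF k(1) j(1), of Q v] Q v(1) last by (simp add: algebra_simps)
      then have "Y k v = 0" using poles[OF k(1) j(1) k(2)] j(2) by simp
      then show "Q \<in> conj_hyperplane n (\<beta> k)"
        unfolding v(4) conj_hyperplane_power_vec
        using proj_point_in_hyperplane[OF v(2,3)] by simp
    qed
    with j(1) show "Q \<in> lagrange_point n \<beta> ` {1..n}" by blast
  qed
  have inf: "infinite {t. \<exists>x\<in>zariski_closure n S. moebius_coords n \<beta> A B C D x t}"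
    by (rule infinite_super[OF _ infinite_param]) (use subset_zariski_closure[OF S_carrier] in blast)
  have "lagrange_point n \<beta> j \<in> closure_S" if "j \<in> {1..n}" for j
    by (rule lagrange_point_in_closure[OF det inf that]) (use poles that in blast)+
  then show "lagrange_point n \<beta> ` {1..n} \<subseteq> closure_S \<inter> hyperplane_at_infinity n"
    using lagrange_point_at_infinity by blast
qed

text \<open>The parameter is recovered from the first coordinate y as (D y - B) / (A - C y), and the
  relations between coordinate 1 and coordinate k propagate it to all coordinates. A zero
  denominator means t = infinity, which is the second alternative.\<close>

lemma closure_affine_point:
  assumes "n \<ge> 1" and Q: "Q \<in> closure_S" "v \<in> Q" and 1: "v $ n = 1"
  obtains t where "\<And>k. k \<in> {1..n} \<Longrightarrow> C k * t + D k \<noteq> 0"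
      "v = from_coords n \<beta> (\<lambda>k. (A k * t + B k) / (C k * t + D k)) 1"
    | "v = from_coords n \<beta> (\<lambda>k. A k / C k) 1"
proof -
  have v: "v \<in> carrier_vec (n + 1)" by (rule closure_S_carrier[OF Q])
  have one: "1 \<in> {1..n}" using assms(1) by simp
  define y where "y = Y 1 v"
  have rel: "(D 1 * y - B 1) * (A k - C k * Y k v) = (D k * Y k v - B k) * (A 1 - C 1 * y)"
    if "k \<in> {1..n}" for k
    using closure_relation[OF one that Q] 1 by (simp add: y_def)
  show ?thesis
  proof (cases "A 1 - C 1 * y = 0")
    case False
    define t where "t = (D 1 * y - B 1) / (A 1 - C 1 * y)"
    have t: "t * (A 1 - C 1 * y) = D 1 * y - B 1" using False by (simp add: t_def)
    have k: "C k * t + D k \<noteq> 0 \<and> Y k v = (A k * t + B k) / (C k * t + D k)" if k: "k \<in> {1..n}" for k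
    proof -
      have "(Y k v * (C k * t + D k) - (A k * t + B k)) * (A 1 - C 1 * y)
          = (D k * Y k v - B k) * (A 1 - C 1 * y) - (t * (A 1 - C 1 * y)) * (A k - C k * Y k v)"
        by (simp add: algebra_simps)
      also have "\<dots> = 0" unfolding t rel[OF k] by simp
      finally have eq: "Y k v * (C k * t + D k) = A k * t + B k" using False by simp
      have "C k * t + D k \<noteq> 0"
      \<comment> \<open>A common zero of numerator and denominator would make the determinant
        vanish.\<close>
      proof
        assume "C k * t + D k = 0"
        moreover with eq have "A k * t + B k = 0" by simp
        moreover have "A k * D k - B k * C k = A k * (C k * t + D k) - C k * (A k * t + B k)"
          by (simp add: algebra_simps)
        ultimately have "A k * D k - B k * C k = 0" by simp
        with det[OF k] show False by simp
      qed
      with eq show ?thesis by (simp add: eq_divide_eq)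
    qed
    have "v = from_coords n \<beta> (\<lambda>k. (A k * t + B k) / (C k * t + D k)) 1"
      by (rule coords_eqI) (use v 1 k in \<open>auto simp: power_vec_from_coords\<close>)
    with k that(1) show ?thesis by blast
  next
    case True
    have s: "D 1 * y - B 1 \<noteq> 0"
    proof
      assume "D 1 * y - B 1 = 0"
      moreover have "A 1 * D 1 - B 1 * C 1 = D 1 * (A 1 - C 1 * y) + C 1 * (D 1 * y - B 1)"
        by (simp add: algebra_simps)
      ultimately have "A 1 * D 1 - B 1 * C 1 = 0" using True by simp
      with det[OF one] show False by simp
    qed
    have k: "Y k v = A k / C k" if k: "k \<in> {1..n}" for k
    proof -
      have eq: "A k = C k * Y k v" using rel[OF k] True s by simp
      with det[OF k] have "C k \<noteq> 0" by auto
      with eq show ?thesis by (simp add: field_simps)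
    qed
    have "v = from_coords n \<beta> (\<lambda>k. A k / C k) 1"
      by (rule coords_eqI) (use v 1 k in \<open>auto simp: power_vec_from_coords\<close>)
    then show ?thesis by (rule that(2))
  qed
qed

text \<open>Fix i with Y_i nonzero. Coordinates with another pole vanish by the bilinear relation,
  and those with the same pole are fixed multiples of Y_i by the linear one. So even with repeated
  poles there are only finitely many points at infinity, which a generic hyperplane can
  avoid.\<close>

lemma closure_infinite_point:
  assumes Q: "Q \<in> closure_S" "v \<in> Q" and 0: "v $ n = 0"
  obtains i c where "i \<in> {1..n}" "c \<noteq> 0"
    "v = c \<cdot>\<^sub>v from_coords n \<beta> (\<lambda>k. if C k * D i = D k * C i
        then (D i * A k - B k * C i) / (D k * A i - B i * C k) else 0) 0"
proof -
  have v: "v \<in> carrier_vec (n + 1)" "v \<noteq> 0\<^sub>v (n + 1)"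
    using Q proj_closure_space proj_space_mem by blast+
  have "\<exists>j\<in>{1..n}. Y j v \<noteq> 0"
  proof (rule ccontr)
    assume "\<not> ?thesis"
    then have "v = 0\<^sub>v (n + 1)"
      using v(1) 0 by (intro coords_eqI) (auto simp: power_vec_scalar_prod)
    with v(2) show False by simp
  qed
  then obtain i where i: "i \<in> {1..n}" "Y i v \<noteq> 0" by blast
  let ?y = "\<lambda>k. if C k * D i = D k * C i then (D i * A k - B k * C i) / (D k * A i - B i * C k) else 0"
  have "Y k v = Y i v * ?y k" if k: "k \<in> {1..n}" for k
  proof (cases "C k * D i = D k * C i")
    case True
    have "(D k * A i - B i * C k) * Y k v = (D i * A k - B k * C i) * Y i v"
      using closure_relation_same_pole[OF i(1) k True Q] 0 by simp
    with same_pole_factor[OF i(1) k True] True show ?thesis by (simp add: field_simps)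
  next
    case False
    have "(C k * D i - D k * C i) * Y i v * Y k v = 0"
      using closure_relation[OF i(1) k Q] 0 by (simp add: algebra_simps)
    with False i(2) show ?thesis by simp
  qed
  then have "v = Y i v \<cdot>\<^sub>v from_coords n \<beta> ?y 0"
    unfolding from_coords_smult using v(1) 0
    by (intro coords_eqI) (auto simp: power_vec_from_coords)
  with i that show ?thesis by blast
qed

text \<open>If two transformations have the same pole, the corresponding coordinates are affinely dependent on
  the curve, so the intersection with a hyperplane is governed by a polynomial of degree below \<open>n\<close>.\<close>

lemma same_pole_not_degree:
  assumes ij: "i0 \<in> {1..n}" "j0 \<in> {1..n}" "i0 \<noteq> j0" "C j0 * D i0 = D j0 * C i0"
  shows "\<not> curve_has_degree n closure_S n"
proof
  assume "curve_has_degree n closure_S n"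
  then obtain G where G: "G \<noteq> 0" "in_vars (n + 1) G"
    and deg: "\<And>h. h \<in> carrier_vec (n + 1) \<Longrightarrow> h \<noteq> 0\<^sub>v (n + 1) \<Longrightarrow> mpoly_eval G h \<noteq> 0 \<Longrightarrow>
        card (closure_S \<inter> proj_hyperplane n h) = n"
    by (auto simp: curve_has_degree_def)
  have n1: "n \<ge> 1" using ij(1) by simp
  let ?y = "\<lambda>t k. (A k * t + B k) / (C k * t + D k)"
  let ?inf = "\<lambda>i k. if C k * D i = D k * C i then (D i * A k - B k * C i) / (D k * A i - B i * C k) else 0"
  obtain t0 x0 where t0: "x0 \<in> S" "moebius_coords n \<beta> A B C D x0 t0"
    using infinite_imp_nonempty[OF infinite_param] by blast
  \<comment> \<open>Avoiding the point of \<open>x0\<close> keeps the section function from being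
    identically zero. Avoiding the image of t = infinity and the possible points at infinity leaves
    only points with a finite parameter. If some \<open>C k\<close> is 0, the quotient defaults to
    0, and the vector is still nonzero because its last entry is 1.\<close>
  define V where "V = insert (homogenize n x0) (insert (from_coords n \<beta> (\<lambda>k. A k / C k) 1)
      ((\<lambda>i. from_coords n \<beta> (?inf i) 0) ` {1..n}))"
  have V: "v \<in> carrier_vec (n + 1) \<and> v \<noteq> 0\<^sub>v (n + 1)" if "v \<in> V" for v
  proof -
    have "from_coords n \<beta> (?inf i) 0 \<noteq> 0\<^sub>v (n + 1)" if i: "i \<in> {1..n}" for i
    proof -
      have "?inf i i \<noteq> 0" using det[OF i] by (simp add: ac_simps)
      then show ?thesis using i by (intro from_coords_nonzero) blast
    qed
    moreover have "from_coords n \<beta> y 1 \<noteq> 0\<^sub>v (n + 1)" for y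
      by (rule from_coords_nonzero) simp
    ultimately show ?thesis
      using that by (auto simp: V_def homogenize_from_coords[OF t0(2)])
  qed
  have "finite V" by (simp add: V_def)
  then obtain h where h: "h \<in> carrier_vec (n + 1)" "mpoly_eval G h \<noteq> 0" "\<And>v. v \<in> V \<Longrightarrow> h \<bullet> v \<noteq> 0"
    using generic_point[OF G _ V] by blast
  have "h \<noteq> 0\<^sub>v (n + 1)" using h(3)[of "homogenize n x0"] by (auto simp: V_def)
  then have card: "card (closure_S \<inter> proj_hyperplane n h) = n"
    by (rule deg[OF h(1) _ h(2)])
  obtain g where g: "\<And>y z. h \<bullet> from_coords n \<beta> y z = (\<Sum>k\<in>{1..n}. g k * y k) + h $ n * z"
    using scalar_prod_from_coords by blast
  define J where "J = {1..n} - {j0}"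
  have J: "finite J" "card J < n" "i0 \<in> J" using ij by (auto simp: J_def)
  let ?q = "D j0 * A i0 - B i0 * C j0"
  \<comment> \<open>\<open>l\<close> and \<open>m\<close> solve the linear same-pole relation for
    Y_j0 on affine points: Y_j0 = l Y_i0 + m. Substituting this into the equation of
    \<open>h\<close> leaves only the n - 1 denominators indexed by \<open>J\<close>.\<close>
  define l where "l = (D i0 * A j0 - B j0 * C i0) / ?q"
  define m where "m = (B j0 * A i0 - B i0 * A j0) / ?q"
  have q: "?q \<noteq> 0" by (rule same_pole_factor[OF ij(1,2,4)])
  have dep: "?y t j0 = l * ?y t i0 + m" if "\<forall>k\<in>{1..n}. C k * t + D k \<noteq> 0" for t
  proof -
    have nz: "C i0 * t + D i0 \<noteq> 0" "C j0 * t + D j0 \<noteq> 0" using that ij(1,2) by auto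
    have "?q * (A j0 * t + B j0) * (C i0 * t + D i0)
        - ((D i0 * A j0 - B j0 * C i0) * (A i0 * t + B i0) + (B j0 * A i0 - B i0 * A j0) * (C i0 * t + D i0)) * (C j0 * t + D j0)
        = (C j0 * D i0 - D j0 * C i0) * (- (A i0 * t + B i0) * (A j0 * t + B j0))"
      by (simp add: algebra_simps)
    then have "?q * (A j0 * t + B j0) * (C i0 * t + D i0)
        = ((D i0 * A j0 - B j0 * C i0) * (A i0 * t + B i0) + (B j0 * A i0 - B i0 * A j0) * (C i0 * t + D i0)) * (C j0 * t + D j0)"
      using ij(4) by simp
    then have "(A j0 * t + B j0) / (C j0 * t + D j0)
        = ((D i0 * A j0 - B j0 * C i0) * (A i0 * t + B i0) + (B j0 * A i0 - B i0 * A j0) * (C i0 * t + D i0))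
          / (?q * (C i0 * t + D i0))"
      using nz q by (simp add: frac_eq_eq ac_simps)
    also have "\<dots> = l * ?y t i0 + m"
      using nz q unfolding l_def m_def by (simp add: add_divide_distrib[of _ _ "?q * (C i0 * t + D i0)"])
    finally show ?thesis .
  qed
  define g' where "g' k = g k + (if k = i0 then g j0 * l else 0)" for k
  define \<mu> where "\<mu> = g j0 * m + h $ n"
  have val: "h \<bullet> from_coords n \<beta> (?y t) 1 = (\<Sum>k\<in>J. g' k * ?y t k) + \<mu>"
    if "\<forall>k\<in>{1..n}. C k * t + D k \<noteq> 0" for t
  proof -
    have "(\<Sum>k\<in>J. g' k * ?y t k) = (\<Sum>k\<in>J. g k * ?y t k + (if k = i0 then g j0 * l * ?y t i0 else 0))"
      by (rule sum.cong) (auto simp: g'_def distrib_right add_divide_distrib)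
    also have "\<dots> = (\<Sum>k\<in>J. g k * ?y t k) + g j0 * l * ?y t i0"
      using J by (simp add: sum.distrib)
    finally have "(\<Sum>k\<in>J. g' k * ?y t k) = (\<Sum>k\<in>J. g k * ?y t k) + g j0 * l * ?y t i0" .
    moreover have "(\<Sum>k\<in>{1..n}. g k * ?y t k) = g j0 * ?y t j0 + (\<Sum>k\<in>J. g k * ?y t k)"
      unfolding J_def using ij(2) by (intro sum.remove) auto
    ultimately show ?thesis
      unfolding g dep[OF that] \<mu>_def by (simp only: algebra_simps mult_1_right mult_1_left)
  qed
  define Z where "Z = {t. (\<forall>k\<in>J. C k * t + D k \<noteq> 0) \<and> (\<Sum>k\<in>J. g' k * ?y t k) + \<mu> = 0}"
  have nonpole: "\<forall>k\<in>{1..n}. C k * t0 + D k \<noteq> 0"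
    using t0(2) by (simp add: moebius_coords_def)
  have "(\<Sum>k\<in>J. g' k * ?y t0 k) + \<mu> \<noteq> 0"
    using h(3)[of "homogenize n x0"]
    unfolding val[OF nonpole, symmetric] homogenize_from_coords[OF t0(2)] by (simp add: V_def homogenize_from_coords[OF t0(2)])
  then have Z: "finite Z" "card Z \<le> card J"
    unfolding Z_def using few_zeros[where J = J and C = C and D = D and A = A and B = B and g = g' and \<mu> = \<mu> and ?t0.0 = t0]
      J(1) nonpole by (auto simp: J_def)
  have "closure_S \<inter> proj_hyperplane n h \<subseteq> (\<lambda>t. proj_point (from_coords n \<beta> (?y t) 1)) ` Z"
  proof
    fix Q assume Q: "Q \<in> closure_S \<inter> proj_hyperplane n h"
    then obtain v where v: "v \<in> Q" "v \<in> carrier_vec (n + 1)" "v \<noteq> 0\<^sub>v (n + 1)" "Q = proj_point v"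
      using proj_closure_space proj_space_nonempty by blast
    have QS: "Q \<in> closure_S" using Q by blast
    have hv: "h \<bullet> v = 0" using Q v(1) by (auto simp: proj_hyperplane_def)
    show "Q \<in> (\<lambda>t. proj_point (from_coords n \<beta> (?y t) 1)) ` Z"
    proof (cases "v $ n = 0")
      case True
      obtain i c where i: "i \<in> {1..n}" "c \<noteq> 0" and vc: "v = c \<cdot>\<^sub>v from_coords n \<beta> (?inf i) 0"
        by (rule closure_infinite_point[OF QS v(1) True])
      have "h \<bullet> from_coords n \<beta> (?inf i) 0 = 0"
        using hv h(1) i(2) unfolding vc by simp
      moreover have "from_coords n \<beta> (?inf i) 0 \<in> V" using i(1) by (auto simp: V_def)
      ultimately show ?thesis using h(3) by blast
    next
      case False
      define w where "w = inverse (v $ n) \<cdot>\<^sub>v v"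
      have Qw: "Q = proj_point w" using False v(4) by (simp add: w_def proj_point_smult)
      have wQ: "w \<in> Q" unfolding Qw by (rule mem_proj_point_self)
      have w1: "w $ n = 1" using False v(2) by (simp add: w_def)
      have hw: "h \<bullet> w = 0" using Q wQ by (auto simp: proj_hyperplane_def)
      show ?thesis
      proof (rule closure_affine_point[OF n1 QS wQ w1])
        fix t
        assume "\<And>k. k \<in> {1..n} \<Longrightarrow> C k * t + D k \<noteq> 0" and w: "w = from_coords n \<beta> (?y t) 1"
        then have nonpole: "\<forall>k\<in>{1..n}. C k * t + D k \<noteq> 0" by blast
        have "t \<in> Z" using hw nonpole unfolding w val[OF nonpole] by (simp add: Z_def J_def)
        then show ?thesis unfolding Qw w by (rule imageI)
      next
        assume "w = from_coords n \<beta> (\<lambda>k. A k / C k) 1"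
        then have "w \<in> V" by (simp add: V_def)
        with h(3) hw show ?thesis by blast
      qed
    qed
  qed
  then have "card (closure_S \<inter> proj_hyperplane n h) \<le> card Z"
    using surj_card_le[OF Z(1)] by blast
  with card Z(2) J(2) show False by simp
qed

end

section \<open>Simple extensions inside the algebraic closure\<close>

interpretation ac: vector_space "\<lambda>(k::'k::field_char_0) x. to_ac k * x"
  by unfold_locales (simp_all add: algebra_simps)

abbreviation ac_poly :: "'k::field_char_0 poly \<Rightarrow> 'k alg_closure poly" where
  "ac_poly \<equiv> map_poly to_ac"

lemma coeff_ac_poly: "coeff (ac_poly p) k = to_ac (coeff p k)"
  by (simp add: coeff_map_poly)

lemma ac_poly_add: "ac_poly (p + q) = ac_poly p + ac_poly q"
  by (rule poly_eqI) (simp add: coeff_map_poly)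

lemma ac_poly_mult: "ac_poly (p * q) = ac_poly p * ac_poly q"
  by (rule poly_eqI) (simp add: coeff_map_poly coeff_mult to_ac_sum)

lemma ac_poly_smult: "ac_poly (smult c p) = smult (to_ac c) (ac_poly p)"
  by (rule poly_eqI) (simp add: coeff_map_poly)

lemma ac_poly_monom: "ac_poly (monom c k) = monom (to_ac c) k"
  by (rule poly_eqI) (simp add: coeff_map_poly)

lemma ac_poly_pderiv: "ac_poly (pderiv p) = pderiv (ac_poly p)"
  by (rule poly_eqI) (simp add: coeff_map_poly coeff_pderiv)

lemma ac_poly_eq_0_iff [simp]: "ac_poly p = 0 \<longleftrightarrow> p = 0"
  by (auto simp: poly_eq_iff coeff_map_poly)

text \<open>Justifies the definite description: algebraicity gives an annihilating polynomial of
  least degree, and the difference of two monic candidates has smaller degree, hence is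
  zero.\<close>

lemma minimal_poly:
  fixes x :: "'k::field_char_0 alg_closure"
  shows "lead_coeff (minimal_poly x) = 1" "poly (ac_poly (minimal_poly x)) x = 0"
    and "\<And>q. q \<noteq> 0 \<Longrightarrow> poly (ac_poly q) x = 0 \<Longrightarrow> degree (minimal_poly x) \<le> degree q"
proof -
  let ?P = "\<lambda>p::'k poly. p \<noteq> 0 \<and> poly (ac_poly p) x = 0"
  let ?Q = "\<lambda>p::'k poly. lead_coeff p = 1 \<and> poly (ac_poly p) x = 0 \<and>
     (\<forall>q. q \<noteq> 0 \<and> poly (ac_poly q) x = 0 \<longrightarrow> degree p \<le> degree q)"
  obtain p where p: "?P p" "\<And>q. ?P q \<Longrightarrow> degree p \<le> degree q"
    using alg_closure_algebraic[of x] ex_has_least_nat[of ?P _ degree] by metis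
  have Q: "?Q (smult (inverse (lead_coeff p)) p)"
    using p by (auto simp: ac_poly_smult)
  have uniq: "p = q" if p: "?Q p" and q: "?Q q" for p q
  proof (rule ccontr)
    assume "p \<noteq> q"
    have "p \<noteq> 0" "q \<noteq> 0" using p q by auto
    then have "degree p \<le> degree q" "degree q \<le> degree p" using p q by blast+
    then have deg: "degree p = degree q" by simp
    have nz: "p - q \<noteq> 0" using \<open>p \<noteq> q\<close> by simp
    have root: "poly (ac_poly (p - q)) x = 0"
    proof -
      have "ac_poly p = ac_poly (p - q) + ac_poly q" by (simp flip: ac_poly_add)
      then show ?thesis using p q by simp
    qed
    have "degree p \<le> degree (p - q)" using p nz root by blast
    moreover have "degree (p - q) \<le> degree p" using degree_diff_le[of p "degree p" q] deg by simp
    moreover have "coeff (p - q) (degree p) = 0" using p q deg by simp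
    ultimately have "lead_coeff (p - q) = 0" by (simp add: order_antisym)
    then have "p - q = 0" by (simp only: leading_coeff_0_iff)
    with nz show False by blast
  qed
  have "\<exists>!p. ?Q p" by (rule ex1I[where P = ?Q, OF Q]) (rule uniq[OF _ Q])
  from theI'[OF this] have "?Q (minimal_poly x)" by (simp add: minimal_poly_def)
  then show "lead_coeff (minimal_poly x) = 1" "poly (ac_poly (minimal_poly x)) x = 0"
    "\<And>q. q \<noteq> 0 \<Longrightarrow> poly (ac_poly q) x = 0 \<Longrightarrow> degree (minimal_poly x) \<le> degree q"
    by blast+
qed

lemma minimal_poly_nonzero [simp]: "minimal_poly x \<noteq> 0"
  using minimal_poly(1)[of x] by auto

lemma degree_minimal_poly: "degree (minimal_poly x) > 0"
proof (rule ccontr)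
  assume "\<not> ?thesis"
  then obtain c where c: "minimal_poly x = [:c:]" by (metis degree_eq_zeroE gr0I)
  then show False using minimal_poly(1,2)[of x] by (simp add: map_poly_pCons)
qed

text \<open>In characteristic zero the derivative is a nonzero polynomial of smaller degree, so
  minimality forbids it to vanish at \<open>x\<close>. This is what later makes the j-th coordinate
  of P_j nonzero.\<close>

lemma minimal_poly_simple_root: "poly (pderiv (ac_poly (minimal_poly x))) x \<noteq> 0"
proof
  assume "poly (pderiv (ac_poly (minimal_poly x))) x = 0"
  moreover have "pderiv (minimal_poly x) \<noteq> 0"
    using degree_minimal_poly[of x] by (simp add: pderiv_eq_0_iff)
  ultimately have "degree (minimal_poly x) \<le> degree (pderiv (minimal_poly x))"
    by (intro minimal_poly(3)) (auto simp: ac_poly_pderiv)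
  then show False using degree_minimal_poly[of x] by (simp add: degree_pderiv)
qed

lemma poly_minimal_poly_mod:
  "poly (ac_poly (p mod minimal_poly x)) x = poly (ac_poly p) x"
proof -
  have "ac_poly p = ac_poly (p div minimal_poly x) * ac_poly (minimal_poly x) + ac_poly (p mod minimal_poly x)"
    by (simp flip: ac_poly_mult ac_poly_add)
  then show ?thesis by (simp add: minimal_poly(2))
qed

lemma subfield_poly_closed:
  assumes "is_subfield E" "\<And>i. coeff p i \<in> E" "x \<in> E"
  shows "poly p x \<in> E"
  using assms(2)
proof (induction p)
  case 0
  then show ?case using assms(1) by (simp add: is_subfield_def)
next
  case (pCons a p)
  have "a \<in> E" using pCons.prems[of 0] by simp
  moreover have "poly p x \<in> E"
    using pCons.prems pCons.IH by (metis coeff_pCons_Suc)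
  ultimately show ?case using assms(1,3) by (simp add: is_subfield_def)
qed

text \<open>Needed for the cofactor M / (t - e) of a minimal polynomial M: it has coefficients in
  the simple extension and serves to move denominators into the base field.\<close>

lemma synthetic_div_coeffs:
  assumes "is_subfield E" "\<And>i. coeff p i \<in> E" "x \<in> E"
  shows "coeff (synthetic_div p x) i \<in> E"
  using assms(2)
proof (induction p arbitrary: i)
  case 0
  then show ?case using assms(1) by (simp add: is_subfield_def)
next
  case (pCons a p)
  have E: "coeff p i \<in> E" for i using pCons.prems[of "Suc i"] by simp
  then have "poly p x \<in> E" by (intro subfield_poly_closed assms)
  with pCons.IH[OF E] show ?case by (cases i) auto
qed

lemma adjoin_eq: "adjoin x = range (\<lambda>p. poly (ac_poly p) x)"
  unfolding adjoin_def
proof (rule hull_unique)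
  let ?R = "range (\<lambda>p. poly (ac_poly p) x)"
  have I: "poly (ac_poly p) x \<in> ?R" for p by blast
  have K: "to_ac k \<in> ?R" for k using I[of "[:k:]"] by (simp add: map_poly_pCons)
  have X: "x \<in> ?R" using I[of "[:0, 1:]"] by (simp add: map_poly_pCons)
  then show "insert x (range to_ac) \<subseteq> ?R" using K by blast
  have add: "y + z \<in> ?R" if "y \<in> ?R" "z \<in> ?R" for y z
    using that I[of "_ + _"] by (auto simp: ac_poly_add)
  have mult: "y * z \<in> ?R" if "y \<in> ?R" "z \<in> ?R" for y z
    using that I[of "_ * _"] by (auto simp: ac_poly_mult)
  have uminus: "- y \<in> ?R" if "y \<in> ?R" for y
    using mult[OF K[of "-1"] that] by simp
  have poly_closed: "poly (ac_poly q) y \<in> ?R" if "y \<in> ?R" for q y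
  proof (induction q)
    case 0
    then show ?case using K[of 0] by simp
  next
    case (pCons a q)
    then show ?case using add[OF K[of a] mult[OF that pCons.IH]] by (simp add: map_poly_pCons)
  qed
  have inv: "inverse y \<in> ?R" if y: "y \<in> ?R" for y
  proof (cases "y = 0")
    case True
    then show ?thesis using K[of 0] by simp
  next
    case False
    \<comment> \<open>Write the minimal polynomial as a + t q(t). Minimality gives a ~= 0, so 1/y =
      - q(y) / a is again a polynomial value.\<close>
    obtain a q where m: "minimal_poly y = pCons a q" by (metis pCons_cases)
    have root: "to_ac a + y * poly (ac_poly q) y = 0"
      using minimal_poly(2)[of y] by (simp add: m map_poly_pCons)
    have "a \<noteq> 0"
    proof
      assume "a = 0"
      then have "poly (ac_poly q) y = 0" "q \<noteq> 0"
        using root False m minimal_poly_nonzero[of y] by auto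
      from minimal_poly(3)[OF this(2,1)] show False using \<open>q \<noteq> 0\<close> by (simp add: m)
    qed
    then have "inverse y = to_ac (- inverse a) * poly (ac_poly q) y"
      using root False by (simp add: field_simps eq_neg_iff_add_eq_0)
    then show ?thesis by (simp only: mult[OF K poly_closed[OF y]])
  qed
  show "is_subfield ?R"
    unfolding is_subfield_def using K[of 0] K[of 1] add mult uminus inv by simp
  fix E assume E: "insert x (range to_ac) \<subseteq> E" "is_subfield E"
  then have "poly (ac_poly p) x \<in> E" for p
    by (intro subfield_poly_closed) (auto simp: coeff_map_poly)
  then show "?R \<subseteq> E" by blast
qed

lemma adjoin_subfield: "is_subfield (adjoin x)"
  unfolding adjoin_def by (rule hull_in) (auto simp: is_subfield_def)

lemma adjoin_generator: "x \<in> adjoin x" and adjoin_base: "to_ac k \<in> adjoin x"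
  unfolding adjoin_def by (auto intro: hull_inc)

section \<open>The power basis of a simple extension\<close>

lemma poly_power_expansion:
  assumes "degree p < m"
  shows "poly (ac_poly p) x = (\<Sum>i<m. to_ac (coeff p i) * x ^ i)"
proof -
  have "poly (ac_poly p) x = (\<Sum>i\<le>degree (ac_poly p). coeff (ac_poly p) i * x ^ i)"
    by (rule poly_altdef)
  also have "\<dots> = (\<Sum>i<m. coeff (ac_poly p) i * x ^ i)"
  proof (rule sum.mono_neutral_left)
    have "degree (ac_poly p) \<le> degree p" 
      by (rule degree_le) (simp add: coeff_map_poly coeff_eq_0)
    with assms show "{..degree (ac_poly p)} \<subseteq> {..<m}" by auto
  qed (auto simp: coeff_eq_0)
  finally show ?thesis by (simp add: coeff_map_poly)
qed

lemma power_lincomb_eq_0: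
  assumes "(\<Sum>i<degree (minimal_poly x). to_ac (c i) * x ^ i) = 0" "i < degree (minimal_poly x)"
  shows "c i = 0"
proof -
  let ?m = "degree (minimal_poly x)"
  define p where "p = (\<Sum>i<?m. monom (c i) i)"
  have coeff: "coeff p i = c i" if "i < ?m" for i using that by (simp add: p_def coeff_sum)
  have "degree p \<le> ?m - 1"
    unfolding p_def by (rule degree_sum_le) (auto intro: order_trans[OF degree_monom_le])
  then have deg: "degree p < ?m" using degree_minimal_poly[of x] by linarith
  have "poly (ac_poly p) x = 0"
    unfolding poly_power_expansion[OF deg] using assms(1) coeff by simp
  with deg minimal_poly(3)[of p x] have "p = 0" by force
  with coeff[OF assms(2)] show ?thesis by simp
qed

lemma adjoin_expansion_degree:
  assumes "y \<in> adjoin x"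
  obtains c where "y = (\<Sum>i<degree (minimal_poly x). to_ac (c i) * x ^ i)"
proof -
  obtain p where p: "y = poly (ac_poly p) x" using assms by (auto simp: adjoin_eq)
  have "degree (p mod minimal_poly x) < degree (minimal_poly x)"
    using degree_mod_less[of "minimal_poly x" p] degree_minimal_poly[of x] by auto
  from poly_power_expansion[OF this, of x] that show ?thesis
    by (simp add: p poly_minimal_poly_mod)
qed

lemma ext_degree_adjoin: "ext_degree (adjoin x) = degree (minimal_poly x)"
  unfolding ext_degree_def
proof (rule ac.dim_unique)
  let ?m = "degree (minimal_poly x)"
  let ?B = "(\<lambda>i. x ^ i) ` {..<?m}"
  \<comment> \<open>The basis is a set, so its size is known only once the powers are distinct;
    equality of two of them would be a linear relation with coefficients 1 and -1.\<close>
  have inj: "inj_on (\<lambda>i. x ^ i) {..<?m}"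
  proof (rule inj_onI, rule ccontr)
    fix i j assume ij: "i \<in> {..<?m}" "j \<in> {..<?m}" "x ^ i = x ^ j" "i \<noteq> j"
    let ?c = "\<lambda>k. (if k = i then 1 else 0) - (if k = j then 1 else 0)"
    have "to_ac (?c k) * x ^ k = (if k = i then x ^ i else 0) - (if k = j then x ^ j else 0)" for k
      by auto
    then have "(\<Sum>k<?m. to_ac (?c k) * x ^ k) = 0"
      using ij(1-3) by (simp add: sum_subtractf)
    from power_lincomb_eq_0[OF this, of i] ij show False by simp
  qed
  then show "card ?B = ?m" by (simp add: card_image)
  show "?B \<subseteq> adjoin x"
  proof
    fix y assume "y \<in> ?B"
    then obtain i where "y = poly (ac_poly (monom 1 i)) x"
      by (auto simp: ac_poly_monom poly_monom)
    then show "y \<in> adjoin x" by (auto simp: adjoin_eq)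
  qed
  show "adjoin x \<subseteq> ac.span ?B"
  proof
    fix y assume "y \<in> adjoin x"
    then obtain c where "y = (\<Sum>i<?m. to_ac (c i) * x ^ i)" by (rule adjoin_expansion_degree)
    then show "y \<in> ac.span ?B" 
      by (simp only:) (intro ac.span_sum ac.span_scale ac.span_base imageI)
  qed
  show "ac.independent ?B"
  proof (rule ac.independent_if_scalars_zero)
    fix f y assume sum: "(\<Sum>y\<in>?B. to_ac (f y) * y) = 0" and y: "y \<in> ?B"
    have "(\<Sum>i<?m. to_ac (f (x ^ i)) * x ^ i) = 0" using sum by (simp add: sum.reindex[OF inj])
    with y show "f y = 0" using power_lincomb_eq_0[of "\<lambda>i. f (x ^ i)" x] by auto
  qed simp
qed

lemma adjoin_expansion:
  assumes "y \<in> adjoin x"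
  obtains c where "y = (\<Sum>i<ext_degree (adjoin x). to_ac (c i) * x ^ i)"
  using adjoin_expansion_degree[OF assms] unfolding ext_degree_adjoin by blast

lemma adjoin_poly_expansion:
  assumes "\<And>k. coeff R k \<in> adjoin x"
  obtains p where "R = (\<Sum>i<ext_degree (adjoin x). smult (x ^ i) (ac_poly (p i)))"
proof -
  let ?n = "ext_degree (adjoin x)"
  have "\<exists>c. coeff R k = (\<Sum>i<?n. to_ac (c i) * x ^ i)" for k
    using adjoin_expansion[OF assms[of k]] by blast
  then obtain c where c: "\<And>k. coeff R k = (\<Sum>i<?n. to_ac (c k i) * x ^ i)" by metis
  define p where "p i = (\<Sum>k\<le>degree R. monom (c k i) k)" for i
  have p: "coeff (p i) k = (if k \<le> degree R then c k i else 0)" for i k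
    by (simp add: p_def coeff_sum)
  have "R = (\<Sum>i<?n. smult (x ^ i) (ac_poly (p i)))"
  proof (rule poly_eqI)
    fix k
    show "coeff R k = coeff (\<Sum>i<?n. smult (x ^ i) (ac_poly (p i))) k"
    proof (cases "k \<le> degree R")
      case True
      then show ?thesis by (simp add: c coeff_sum coeff_map_poly p mult.commute)
    next
      case False
      then show ?thesis by (simp add: coeff_sum coeff_map_poly p coeff_eq_0)
    qed
  qed
  with that show ?thesis by blast
qed

section \<open>Conjugation\<close>

text \<open>The property defining the hull is stable under intersections, so the hull itself has
  it.\<close>

lemma normal_closure_subfield: "is_subfield (normal_closure E)"
proof -
  let ?P = "\<lambda>N. is_subfield N \<and> range to_ac \<subseteq> N \<and> (\<forall>x\<in>N. conjugates x \<subseteq> N)"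
  have "?P (\<Inter>T)" if T: "Ball T ?P" for T
  proof (intro conjI)
    have "\<forall>N\<in>T. is_subfield N" using T by blast
    then show "is_subfield (\<Inter>T)" by (auto simp: is_subfield_def)
    show "range to_ac \<subseteq> \<Inter>T" using T by (intro Inter_greatest) blast
    show "\<forall>x\<in>\<Inter>T. conjugates x \<subseteq> \<Inter>T" using T by (intro ballI Inter_greatest) blast
  qed
  from hull_in[of ?P, OF this] show ?thesis unfolding normal_closure_def by blast
qed

lemma subset_normal_closure: "E \<subseteq> normal_closure E"
  unfolding normal_closure_def by (rule hull_subset)

text \<open>Outside \<open>N\<close> the map \<open>s\<close> is unconstrained, so the rules for
  sums, products and polynomial values carry membership premises.\<close>

locale base_embedding =
  fixes N :: "'k::field_char_0 alg_closure set" and s :: "'k alg_closure \<Rightarrow> 'k alg_closure"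
  assumes subfield: "is_subfield N" and base: "range to_ac \<subseteq> N" and auto: "base_automorphism N s"
begin

lemma closed:
  "to_ac k \<in> N" "x \<in> N \<Longrightarrow> y \<in> N \<Longrightarrow> x + y \<in> N" "x \<in> N \<Longrightarrow> y \<in> N \<Longrightarrow> x * y \<in> N"
  "x \<in> N \<Longrightarrow> - x \<in> N"
  using subfield base by (auto simp: is_subfield_def)

lemma fixes_base: "s (to_ac k) = to_ac k" and add: "x \<in> N \<Longrightarrow> y \<in> N \<Longrightarrow> s (x + y) = s x + s y"
  and mult: "x \<in> N \<Longrightarrow> y \<in> N \<Longrightarrow> s (x * y) = s x * s y"
  using auto by (auto simp: base_automorphism_def)

lemma zero: "s 0 = 0" and one: "s 1 = 1"
  using fixes_base[of 0] fixes_base[of 1] by simp_all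

lemma uminus: "x \<in> N \<Longrightarrow> s (- x) = - s x"
  using mult[of "to_ac (-1)" x] fixes_base[of "-1"] closed(1)[of "-1"] by simp

lemma diff: "x \<in> N \<Longrightarrow> y \<in> N \<Longrightarrow> s (x - y) = s x - s y"
  using add[of x "- y"] uminus closed(4) by simp

lemma diff_closed: "x \<in> N \<Longrightarrow> y \<in> N \<Longrightarrow> x - y \<in> N"
  using closed(2)[of x "- y"] closed(4) by simp

lemma eq_0_iff: "x \<in> N \<Longrightarrow> s x = 0 \<longleftrightarrow> x = 0"
proof -
  assume "x \<in> N"
  moreover have "inj_on s N" using auto by (simp add: base_automorphism_def bij_betw_def)
  moreover have "0 \<in> N" using subfield by (simp add: is_subfield_def)
  ultimately show ?thesis using zero by (metis inj_onD)
qed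

lemma power_closed: "x \<in> N \<Longrightarrow> x ^ k \<in> N"
  using closed(1)[of 1] by (induction k) (auto simp: closed)

lemma power: "x \<in> N \<Longrightarrow> s (x ^ k) = s x ^ k"
  by (induction k) (auto simp: one mult power_closed)

lemma sum_closed: "(\<And>i. i \<in> I \<Longrightarrow> f i \<in> N) \<Longrightarrow> (\<Sum>i\<in>I. f i) \<in> N"
  using closed(1)[of 0] by (induction I rule: infinite_finite_induct) (auto simp: closed)

lemma sum: "(\<And>i. i \<in> I \<Longrightarrow> f i \<in> N) \<Longrightarrow> s (\<Sum>i\<in>I. f i) = (\<Sum>i\<in>I. s (f i))"
  by (induction I rule: infinite_finite_induct) (auto simp: zero add sum_closed)

lemma poly_closed: "x \<in> N \<Longrightarrow> poly (ac_poly p) x \<in> N"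
  by (rule subfield_poly_closed[OF subfield]) (auto simp: coeff_map_poly closed)

lemma poly: "x \<in> N \<Longrightarrow> s (poly (ac_poly p) x) = poly (ac_poly p) (s x)"
  by (induction p) (auto simp: zero map_poly_pCons add mult closed fixes_base poly_closed)

text \<open>Compares coefficients and applies \<open>s\<close> to each: those of \<open>q\<close>
  and \<open>p i\<close> lie in the base field and stay fixed, so only a, b, c, d and x are
  conjugated. Working with a cleared polynomial identity avoids extending \<open>s\<close> to
  rational functions.\<close>

lemma conjugate_identity:
  assumes abcd: "a \<in> N" "b \<in> N" "c \<in> N" "d \<in> N" "x \<in> N"
    and eq: "[:b, a:] * ac_poly q = [:d, c:] * (\<Sum>i<n. smult (x ^ i) (ac_poly (p i)))"
  shows "[:s b, s a:] * ac_poly q = [:s d, s c:] * (\<Sum>i<n. smult (s x ^ i) (ac_poly (p i)))"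
proof (rule poly_eqI)
  fix k
  define r where "r = (\<Sum>i<n. smult (x ^ i) (ac_poly (p i)))"
  define r' where "r' = (\<Sum>i<n. smult (s x ^ i) (ac_poly (p i)))"
  have r: "coeff r k \<in> N" "s (coeff r k) = coeff r' k" for k
  proof -
    have *: "coeff r k = (\<Sum>i<n. x ^ i * to_ac (coeff (p i) k))"
      by (simp add: r_def coeff_sum coeff_map_poly)
    show "coeff r k \<in> N" unfolding * by (intro sum_closed closed power_closed abcd)
    have "s (coeff r k) = (\<Sum>i<n. s (x ^ i * to_ac (coeff (p i) k)))"
      unfolding * by (intro sum closed power_closed abcd)
    also have "\<dots> = coeff r' k"
      by (simp add: r'_def coeff_sum coeff_map_poly mult power power_closed closed fixes_base abcd(5))
    finally show "s (coeff r k) = coeff r' k" .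
  qed
  have lin: "coeff ([:y, z:] * w) k = y * coeff w k + z * (if k = 0 then 0 else coeff w (k - 1))"
    for y z :: "'k alg_closure" and w
    by (cases k) auto
  have "s (b * to_ac (coeff q k) + a * (if k = 0 then to_ac 0 else to_ac (coeff q (k - 1))))
      = s (d * coeff r k + c * (if k = 0 then 0 else coeff r (k - 1)))"
    using arg_cong[OF eq, of "\<lambda>w. coeff w k"] unfolding r_def[symmetric] lin coeff_ac_poly
    by (cases "k = 0") simp_all
  moreover have "s (b * to_ac (coeff q k) + a * (if k = 0 then to_ac 0 else to_ac (coeff q (k - 1))))
      = s b * to_ac (coeff q k) + s a * (if k = 0 then 0 else to_ac (coeff q (k - 1)))"
    using abcd closed(1)[of 0] by (simp add: add mult closed fixes_base zero)
  moreover have "s (d * coeff r k + c * (if k = 0 then 0 else coeff r (k - 1)))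
      = s d * coeff r' k + s c * (if k = 0 then 0 else coeff r' (k - 1))"
    using abcd closed(1)[of 0] r by (simp add: add mult closed zero)
  ultimately show "coeff ([:s b, s a:] * ac_poly q) k
      = coeff ([:s d, s c:] * (\<Sum>i<n. smult (s x ^ i) (ac_poly (p i)))) k"
    unfolding r'_def[symmetric] lin coeff_ac_poly by simp
qed

end

lemma conjugating_base_embedding:
  assumes "conjugating_automorphisms \<alpha> \<sigma>" "j \<in> {1..ext_degree (adjoin \<alpha>)}"
  shows "base_embedding (normal_closure (adjoin \<alpha>)) (\<sigma> j)"
proof
  show "is_subfield (normal_closure (adjoin \<alpha>))" by (rule normal_closure_subfield)
  show "range to_ac \<subseteq> normal_closure (adjoin \<alpha>)"
    using adjoin_base subset_normal_closure[of "adjoin \<alpha>"] by blast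
  show "base_automorphism (normal_closure (adjoin \<alpha>)) (\<sigma> j)"
    using assms by (simp add: conjugating_automorphisms_def)
qed

section \<open>Coordinates of a unit\<close>

text \<open>By coprimality the denominator of the reduced fraction divides every other denominator,
  so any representation whose denominator is nonzero at t gives the same value.\<close>

lemma rat_eval_Fract:
  assumes "f = Fract p q" "poly q t \<noteq> 0"
  shows "rat_defined f t" "rat_eval f t = poly p t / poly q t"
proof -
  let ?a = "fst (quot_of_fract f)" and ?b = "snd (quot_of_fract f)"
  have q: "q \<noteq> 0" using assms(2) by auto
  have "Fract ?a ?b = Fract p q" unfolding Fract_quot_of_fract by (rule assms(1))
  then have eq: "?a * q = p * ?b" unfolding eq_fract(1)[OF snd_quot_of_fract_nonzero q] .
  have "coprime ?a ?b" by (rule coprime_quot_of_fract)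
  moreover have "?b dvd ?a * q" unfolding eq by simp
  ultimately have "?b dvd q" by (metis coprime_commute coprime_dvd_mult_right_iff)
  then show *: "rat_defined f t" using assms(2) by (auto simp: rat_defined_def elim!: dvdE)
  have "poly ?a t * poly q t = poly p t * poly ?b t"
    using arg_cong[OF eq, of "\<lambda>r. poly r t"] by simp
  then show "rat_eval f t = poly p t / poly q t"
    using assms(2) * by (simp add: rat_eval_def rat_defined_def frac_eq_eq)
qed

lemma rat_definedE:
  assumes "rat_defined f t"
  obtains p q where "f = Fract p q" "poly q t \<noteq> 0" "rat_eval f t = poly p t / poly q t"
  using assms that[of "fst (quot_of_fract f)" "snd (quot_of_fract f)"]
  by (simp add: rat_defined_def rat_eval_def)

lemma rat_eval_to_fract: "rat_defined (to_fract p) t" "rat_eval (to_fract p) t = poly p t"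
  by (simp_all add: rat_defined_def rat_eval_def)

lemma rat_eval_add:
  assumes "rat_defined f t" "rat_defined g t"
  shows "rat_defined (f + g) t" "rat_eval (f + g) t = rat_eval f t + rat_eval g t"
proof -
  obtain p q where f: "f = Fract p q" "poly q t \<noteq> 0" "rat_eval f t = poly p t / poly q t"
    using assms(1) by (rule rat_definedE)
  obtain p' q' where g: "g = Fract p' q'" "poly q' t \<noteq> 0" "rat_eval g t = poly p' t / poly q' t"
    using assms(2) by (rule rat_definedE)
  have "q \<noteq> 0" "q' \<noteq> 0" using f(2) g(2) by auto
  then have "f + g = Fract (p * q' + p' * q) (q * q')" by (simp add: f(1) g(1))
  from rat_eval_Fract[OF this, of t] f g
  show "rat_defined (f + g) t" "rat_eval (f + g) t = rat_eval f t + rat_eval g t"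
    by (simp_all add: add_frac_eq)
qed

lemma rat_eval_mult:
  assumes "rat_defined f t" "rat_defined g t"
  shows "rat_defined (f * g) t" "rat_eval (f * g) t = rat_eval f t * rat_eval g t"
proof -
  obtain p q where f: "f = Fract p q" "poly q t \<noteq> 0" "rat_eval f t = poly p t / poly q t"
    using assms(1) by (rule rat_definedE)
  obtain p' q' where g: "g = Fract p' q'" "poly q' t \<noteq> 0" "rat_eval g t = poly p' t / poly q' t"
    using assms(2) by (rule rat_definedE)
  have "f * g = Fract (p * p') (q * q')" by (simp add: f(1) g(1))
  from rat_eval_Fract[OF this, of t] f g
  show "rat_defined (f * g) t" "rat_eval (f * g) t = rat_eval f t * rat_eval g t" by simp_all
qed

lemma rat_eval_sum:
  assumes "finite I" "\<And>i. i \<in> I \<Longrightarrow> rat_defined (f i) t"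
  shows "rat_defined (\<Sum>i\<in>I. f i) t \<and> rat_eval (\<Sum>i\<in>I. f i) t = (\<Sum>i\<in>I. rat_eval (f i) t)"
  using assms
proof (induction I rule: finite_induct)
  case empty
  then show ?case using rat_eval_to_fract[of 0 t] by simp
qed (simp add: rat_eval_add)

lemma finite_rat_undefined: "finite {t. \<not> rat_defined f t}"
  unfolding rat_defined_def not_not by (rule poly_roots_finite) simp

text \<open>The denominator is moved into the base field by multiplying with the cofactor of the
  pole in its minimal polynomial; the numerator keeps coefficients in the extension and is split
  along the power basis.\<close>

lemma unit_expansion:
  assumes "is_unit_over (adjoin x) u"
  obtains p q where "q \<noteq> 0"
    "u = Fract (\<Sum>i<ext_degree (adjoin x). smult (x ^ i) (ac_poly (p i))) (ac_poly q)"
proof -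
  let ?L = "adjoin x"
  have L: "0 \<in> ?L" "\<And>y z. y \<in> ?L \<Longrightarrow> z \<in> ?L \<Longrightarrow> y + z \<in> ?L" "\<And>y z. y \<in> ?L \<Longrightarrow> z \<in> ?L \<Longrightarrow> y * z \<in> ?L"
    "\<And>y. y \<in> ?L \<Longrightarrow> - y \<in> ?L" "\<And>y. y \<in> ?L \<Longrightarrow> inverse y \<in> ?L"
    using adjoin_subfield[of x] by (auto simp: is_subfield_def)
  obtain a b c d where abcd: "a \<in> ?L" "b \<in> ?L" "c \<in> ?L" "d \<in> ?L" "a * d - b * c \<noteq> 0"
    and u: "u = Fract [:b, a:] [:d, c:]"
    using assms by (auto simp: is_unit_over_def)
  have "\<exists>R q. (\<forall>k. coeff R k \<in> ?L) \<and> q \<noteq> 0 \<and> u = Fract R (ac_poly q)"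
  proof (cases "c = 0")
    case True
    then have d: "d \<noteq> 0" using abcd by auto
    have "coeff (smult (inverse d) [:b, a:]) k \<in> ?L" for k
      using abcd L by (auto simp: coeff_pCons split: nat.split)
    moreover have "u = Fract (smult (inverse d) [:b, a:]) (ac_poly 1)"
      using d True by (simp add: u eq_fract)
    ultimately show ?thesis by (metis one_neq_zero)
  next
    case False
    \<comment> \<open>The pole of u.\<close>
    define e where "e = - d * inverse c"
    have e: "e \<in> ?L" unfolding e_def by (intro L(3-5) abcd)
    let ?M = "ac_poly (minimal_poly e)"
    define R where "R = synthetic_div ?M e"
    have R: "coeff R k \<in> ?L" for k
      unfolding R_def
      by (rule synthetic_div_coeffs[OF adjoin_subfield _ e]) (simp add: coeff_map_poly adjoin_base)
    have M: "?M = [:- e, 1:] * R"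
      using synthetic_div_correct'[of e ?M] by (simp add: R_def minimal_poly(2))
    have dc: "[:d, c:] = smult c [:- e, 1:]" using False by (simp add: e_def)
    have cM: "[:d, c:] * R = smult c ?M" unfolding dc M mult_smult_left ..
    have "coeff ([:b, a:] * R) k \<in> ?L" for k
      using R abcd L by (cases k) auto
    then have "coeff (smult (inverse c) ([:b, a:] * R)) k \<in> ?L" for k
      using abcd L by simp
    moreover have "u = Fract (smult (inverse c) ([:b, a:] * R)) ?M"
    proof -
      have "[:d, c:] \<noteq> 0" "?M \<noteq> 0" using False by auto
      moreover have "[:b, a:] * ?M = smult (inverse c) ([:b, a:] * R) * [:d, c:]"
      proof -
        have "smult (inverse c) ([:b, a:] * R) * [:d, c:] = smult (inverse c) ([:b, a:] * ([:d, c:] * R))"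
          by (simp only: mult_smult_left mult_smult_right mult_ac)
        also have "\<dots> = [:b, a:] * ?M" unfolding cM using False by simp
        finally show ?thesis ..
      qed
      ultimately show ?thesis unfolding u by (subst eq_fract(1))
    qed
    ultimately show ?thesis using minimal_poly_nonzero by blast
  qed
  then obtain R q where R: "\<And>k. coeff R k \<in> ?L" "q \<noteq> 0" "u = Fract R (ac_poly q)" by blast
  obtain p where "R = (\<Sum>i<ext_degree ?L. smult (x ^ i) (ac_poly (p i)))"
    using adjoin_poly_expansion[OF R(1)] by blast
  with R that show ?thesis by blast
qed

text \<open>\<open>alpha_coords\<close> is a choice, so its two defining properties hold as soon as
  \<open>unit_expansion\<close> supplies a witness.\<close>

lemma alpha_coords:
  assumes "is_unit_over (adjoin \<alpha>) u"
  shows "\<And>i. i < ext_degree (adjoin \<alpha>) \<Longrightarrow> alpha_coords \<alpha> u i \<in> base_rat_funs"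
    and "u = (\<Sum>i<ext_degree (adjoin \<alpha>). alpha_coords \<alpha> u i * to_fract [:\<alpha> ^ i:])"
proof -
  let ?P = "\<lambda>\<phi>. (\<forall>i<ext_degree (adjoin \<alpha>). \<phi> i \<in> base_rat_funs) \<and>
     u = (\<Sum>i<ext_degree (adjoin \<alpha>). \<phi> i * to_fract [:\<alpha> ^ i:])"
  obtain p q where q: "q \<noteq> 0"
    and u: "u = Fract (\<Sum>i<ext_degree (adjoin \<alpha>). smult (\<alpha> ^ i) (ac_poly (p i))) (ac_poly q)"
    using assms by (rule unit_expansion)
  have "smult (\<alpha> ^ i) (ac_poly (p i)) = ac_poly (p i) * [:\<alpha> ^ i:]" for i by simp
  then have "u = (\<Sum>i<ext_degree (adjoin \<alpha>). Fract (ac_poly (p i)) (ac_poly q) * to_fract [:\<alpha> ^ i:])"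
    unfolding u Fract_conv_to_fract by (simp add: sum_divide_distrib del: mult_pCons_right)
  moreover have "Fract (ac_poly (p i)) (ac_poly q) \<in> base_rat_funs" for i
    using q by (auto simp: base_rat_funs_def)
  ultimately have "?P (\<lambda>i. Fract (ac_poly (p i)) (ac_poly q))" by blast
  then have "?P (alpha_coords \<alpha> u)" unfolding alpha_coords_def by (rule someI[of ?P])
  then show "\<And>i. i < ext_degree (adjoin \<alpha>) \<Longrightarrow> alpha_coords \<alpha> u i \<in> base_rat_funs"
    and "u = (\<Sum>i<ext_degree (adjoin \<alpha>). alpha_coords \<alpha> u i * to_fract [:\<alpha> ^ i:])" by blast+
qed

lemma base_rat_funs_common_denominator:
  fixes n :: nat
  assumes "\<And>i. i < n \<Longrightarrow> \<phi> i \<in> base_rat_funs"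
  shows "\<exists>p q. q \<noteq> 0 \<and> (\<forall>i<n. \<phi> i = Fract (ac_poly (p i)) (ac_poly q))"
proof -
  have "\<exists>r s. i < n \<longrightarrow> s \<noteq> 0 \<and> \<phi> i = Fract (ac_poly r) (ac_poly s)" for i
    using assms by (fastforce simp: base_rat_funs_def)
  then obtain r s where rs: "\<And>i. i < n \<Longrightarrow> s i \<noteq> 0 \<and> \<phi> i = Fract (ac_poly (r i)) (ac_poly (s i))"
    by metis
  define q where "q = (\<Prod>i<n. s i)"
  have q: "q \<noteq> 0" using rs by (simp add: q_def)
  have "\<phi> i = Fract (ac_poly (r i * (\<Prod>k\<in>{..<n} - {i}. s k))) (ac_poly q)" if i: "i < n" for i
  proof -
    have "q = s i * (\<Prod>k\<in>{..<n} - {i}. s k)" unfolding q_def using i by (simp add: prod.remove)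
    then have "ac_poly q = ac_poly (s i) * ac_poly (\<Prod>k\<in>{..<n} - {i}. s k)"
      by (simp add: ac_poly_mult)
    moreover have "ac_poly q \<noteq> 0" "ac_poly (s i) \<noteq> 0" using q rs[OF i] by simp_all
    ultimately show ?thesis using rs[OF i] by (simp add: eq_fract ac_poly_mult ac_simps)
  qed
  with q show ?thesis by (intro exI[of _ "\<lambda>i. r i * (\<Prod>k\<in>{..<n} - {i}. s k)"] exI[of _ q]) simp
qed

text \<open>Over a common denominator the expansion of u becomes a polynomial identity that can be
  conjugated and then evaluated at t. If the conjugated denominator vanished at t, so would the
  numerator, and \<open>s (a * d - b * c)\<close> would be 0.\<close>

lemma conjugate_coordinates:
  assumes emb: "base_embedding N s"
    and abcd: "a \<in> N" "b \<in> N" "c \<in> N" "d \<in> N" "\<alpha> \<in> N" "a * d - b * c \<noteq> 0"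
    and \<phi>: "\<And>i. i < n \<Longrightarrow> \<phi> i \<in> base_rat_funs"
    and u: "Fract [:b, a:] [:d, c:] = (\<Sum>i<n. \<phi> i * to_fract [:\<alpha> ^ i:])"
    and t: "\<And>i. i < n \<Longrightarrow> rat_defined (\<phi> i) t"
  shows "s c * t + s d \<noteq> 0" "(\<Sum>i<n. s \<alpha> ^ i * rat_eval (\<phi> i) t) = (s a * t + s b) / (s c * t + s d)"
proof -
  interpret base_embedding N s by (rule emb)
  obtain p q where q: "q \<noteq> 0" and pq: "\<And>i. i < n \<Longrightarrow> \<phi> i = Fract (ac_poly (p i)) (ac_poly q)"
    using base_rat_funs_common_denominator[of n \<phi>, OF \<phi>] by blast
  have common: "(\<Sum>i<n. \<phi> i * to_fract [:y ^ i:])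
      = to_fract (\<Sum>i<n. smult (y ^ i) (ac_poly (p i))) / to_fract (ac_poly q)" for y
  proof -
    have "smult (y ^ i) (ac_poly (p i)) = ac_poly (p i) * [:y ^ i:]" for i by simp
    then show ?thesis
      by (simp add: pq Fract_conv_to_fract sum_divide_distrib del: mult_pCons_right)
  qed
  have dc: "[:d, c:] \<noteq> 0" using abcd(6) by auto
  have "to_fract [:b, a:] / to_fract [:d, c:]
      = to_fract (\<Sum>i<n. smult (\<alpha> ^ i) (ac_poly (p i))) / to_fract (ac_poly q)"
    using u unfolding common Fract_conv_to_fract .
  then have "to_fract [:b, a:] * to_fract (ac_poly q)
      = to_fract [:d, c:] * to_fract (\<Sum>i<n. smult (\<alpha> ^ i) (ac_poly (p i)))"
    using dc q by (simp add: frac_eq_eq mult.commute del: to_fract_sum)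
  then have "[:b, a:] * ac_poly q = [:d, c:] * (\<Sum>i<n. smult (\<alpha> ^ i) (ac_poly (p i)))"
    unfolding to_fract_mult[symmetric] to_fract_eq_iff .
  from conjugate_identity[OF abcd(1-5) this]
  have "to_fract [:s b, s a:] * to_fract (ac_poly q)
      = to_fract [:s d, s c:] * to_fract (\<Sum>i<n. smult (s \<alpha> ^ i) (ac_poly (p i)))"
    unfolding to_fract_mult[symmetric] to_fract_eq_iff .
  then have fract: "to_fract [:s b, s a:] = to_fract [:s d, s c:] * (\<Sum>i<n. \<phi> i * to_fract [:s \<alpha> ^ i:])"
    unfolding common using q by (simp add: eq_divide_eq del: to_fract_sum)
  have defd: "rat_defined (\<phi> i * to_fract [:s \<alpha> ^ i:]) t"
    "rat_eval (\<phi> i * to_fract [:s \<alpha> ^ i:]) t = s \<alpha> ^ i * rat_eval (\<phi> i) t" if "i < n" for i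
    using rat_eval_mult[OF t[OF that] rat_eval_to_fract(1)] by (simp_all add: rat_eval_to_fract)
  have sum: "rat_defined (\<Sum>i<n. \<phi> i * to_fract [:s \<alpha> ^ i:]) t \<and>
      rat_eval (\<Sum>i<n. \<phi> i * to_fract [:s \<alpha> ^ i:]) t = (\<Sum>i<n. s \<alpha> ^ i * rat_eval (\<phi> i) t)"
    using rat_eval_sum[of "{..<n}" "\<lambda>i. \<phi> i * to_fract [:s \<alpha> ^ i:]" t] defd by simp
  have eval: "s a * t + s b = (s c * t + s d) * (\<Sum>i<n. s \<alpha> ^ i * rat_eval (\<phi> i) t)"
    using arg_cong[OF fract, of "\<lambda>f. rat_eval f t"]
      rat_eval_mult(2)[OF rat_eval_to_fract(1)[of "[:s d, s c:]"] conjunct1[OF sum]] sum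
    by (simp add: rat_eval_to_fract ac_simps)
  show nz: "s c * t + s d \<noteq> 0"
  proof
    assume 0: "s c * t + s d = 0"
    with eval have "s a * t + s b = 0" by simp
    moreover have "s a * s d - s b * s c = s a * (s c * t + s d) - s c * (s a * t + s b)"
      by (simp add: algebra_simps)
    ultimately have "s (a * d - b * c) = 0"
      using 0 abcd by (simp add: diff mult closed)
    then show False using eq_0_iff abcd by (simp add: diff_closed closed)
  qed
  show "(\<Sum>i<n. s \<alpha> ^ i * rat_eval (\<phi> i) t) = (s a * t + s b) / (s c * t + s d)"
    using eval nz by (simp add: field_simps)
qed

section \<open>Primitive hypercircles\<close>

lemma hypercircle_moebius_curve:
  fixes \<alpha> :: "'k::field_char_0 alg_closure"
  assumes n: "n = ext_degree (adjoin \<alpha>)" and sigma: "conjugating_automorphisms \<alpha> \<sigma>"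
    and abcd: "a \<in> adjoin \<alpha>" "b \<in> adjoin \<alpha>" "c \<in> adjoin \<alpha>" "d \<in> adjoin \<alpha>" "a * d - b * c \<noteq> 0"
  obtains S where
    "moebius_curve n (\<lambda>j. \<sigma> j \<alpha>) (\<lambda>j. \<sigma> j a) (\<lambda>j. \<sigma> j b) (\<lambda>j. \<sigma> j c) (\<lambda>j. \<sigma> j d) S"
    "hypercircle \<alpha> (Fract [:b, a:] [:d, c:]) = zariski_closure n S"
proof -
  let ?u = "Fract [:b, a:] [:d, c:]"
  let ?N = "normal_closure (adjoin \<alpha>)"
  have unit: "is_unit_over (adjoin \<alpha>) ?u" using abcd unfolding is_unit_over_def by blast
  define \<phi> where "\<phi> = alpha_coords \<alpha> ?u"
  define S where "S = {vec n (\<lambda>i. rat_eval (\<phi> i) t) |t. \<forall>i<n. rat_defined (\<phi> i) t}"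
  note coords = alpha_coords[OF unit, folded n \<phi>_def]
  have emb: "base_embedding ?N (\<sigma> j)" if "j \<in> {1..n}" for j
    using conjugating_base_embedding[OF sigma] that n by simp
  have N: "a \<in> ?N" "b \<in> ?N" "c \<in> ?N" "d \<in> ?N" "\<alpha> \<in> ?N"
    using abcd adjoin_generator[of \<alpha>] subset_normal_closure[of "adjoin \<alpha>"] by auto
  have moebius: "moebius_coords n (\<lambda>j. \<sigma> j \<alpha>) (\<lambda>j. \<sigma> j a) (\<lambda>j. \<sigma> j b) (\<lambda>j. \<sigma> j c) (\<lambda>j. \<sigma> j d)
      (vec n (\<lambda>i. rat_eval (\<phi> i) t)) t" if t: "\<forall>i<n. rat_defined (\<phi> i) t" for t
    unfolding moebius_coords_def
  proof (intro ballI conjI)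
    fix j assume j: "j \<in> {1..n}"
    note conj = conjugate_coordinates[OF emb[OF j] N abcd(5) coords, of t]
    show "\<sigma> j c * t + \<sigma> j d \<noteq> 0" using conj(1) t by blast
    have "power_vec n (\<sigma> j \<alpha>) \<bullet> homogenize n (vec n (\<lambda>i. rat_eval (\<phi> i) t))
        = (\<Sum>i<n. \<sigma> j \<alpha> ^ i * rat_eval (\<phi> i) t)"
      by (simp add: power_vec_scalar_prod homogenize_def)
    also have "\<dots> = (\<sigma> j a * t + \<sigma> j b) / (\<sigma> j c * t + \<sigma> j d)" using conj(2) t by blast
    finally show "power_vec n (\<sigma> j \<alpha>) \<bullet> homogenize n (vec n (\<lambda>i. rat_eval (\<phi> i) t))
        = (\<sigma> j a * t + \<sigma> j b) / (\<sigma> j c * t + \<sigma> j d)" .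
  qed
  have "moebius_curve n (\<lambda>j. \<sigma> j \<alpha>) (\<lambda>j. \<sigma> j a) (\<lambda>j. \<sigma> j b) (\<lambda>j. \<sigma> j c) (\<lambda>j. \<sigma> j d) S"
  proof
    show "inj_on (\<lambda>j. \<sigma> j \<alpha>) {1..n}"
      using sigma n by (auto simp: conjugating_automorphisms_def bij_betw_def)
    show "\<sigma> k a * \<sigma> k d - \<sigma> k b * \<sigma> k c \<noteq> 0" if k: "k \<in> {1..n}" for k
    proof -
      interpret base_embedding ?N "\<sigma> k" by (rule emb[OF k])
      show ?thesis
        using eq_0_iff[of "a * d - b * c"] abcd(5) N by (simp add: diff mult closed diff_closed)
    qed
    show "S \<subseteq> carrier_vec n" by (auto simp: S_def)
    show "\<exists>t. moebius_coords n (\<lambda>j. \<sigma> j \<alpha>) (\<lambda>j. \<sigma> j a) (\<lambda>j. \<sigma> j b) (\<lambda>j. \<sigma> j c) (\<lambda>j. \<sigma> j d) x t"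
      if "x \<in> S" for x
      using that moebius unfolding S_def by blast
    have "finite (\<Union>i<n. {t. \<not> rat_defined (\<phi> i) t})" by (intro finite_UN_I finite_rat_undefined) simp
    then have "infinite (- (\<Union>i<n. {t. \<not> rat_defined (\<phi> i) t}))"
      using infinite_UNIV_char_0 by (metis finite_compl)
    moreover have "- (\<Union>i<n. {t. \<not> rat_defined (\<phi> i) t}) \<subseteq> {t. \<exists>x\<in>S. moebius_coords n (\<lambda>j. \<sigma> j \<alpha>)
        (\<lambda>j. \<sigma> j a) (\<lambda>j. \<sigma> j b) (\<lambda>j. \<sigma> j c) (\<lambda>j. \<sigma> j d) x t}"
      using moebius unfolding S_def by auto
    ultimately show "infinite {t. \<exists>x\<in>S. moebius_coords n (\<lambda>j. \<sigma> j \<alpha>)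
        (\<lambda>j. \<sigma> j a) (\<lambda>j. \<sigma> j b) (\<lambda>j. \<sigma> j c) (\<lambda>j. \<sigma> j d) x t}"
      using infinite_super by blast
  qed
  moreover have "hypercircle \<alpha> ?u = zariski_closure n S"
    by (simp add: hypercircle_def Let_def S_def \<phi>_def n)
  ultimately show ?thesis by (rule that)
qed

lemma primitive_distinct_poles:
  fixes \<alpha> :: "'k::field_char_0 alg_closure"
  assumes n: "n = ext_degree (adjoin \<alpha>)" and sigma: "conjugating_automorphisms \<alpha> \<sigma>"
    and abcd: "a \<in> adjoin \<alpha>" "b \<in> adjoin \<alpha>" "c \<in> adjoin \<alpha>" "d \<in> adjoin \<alpha>" "a * d - b * c \<noteq> 0"
    and U: "U = hypercircle \<alpha> (Fract [:b, a:] [:d, c:])" "primitive_hypercircle \<alpha> U"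
  shows "\<And>i j. i \<in> {1..n} \<Longrightarrow> j \<in> {1..n} \<Longrightarrow> i \<noteq> j \<Longrightarrow> \<sigma> j c * \<sigma> i d \<noteq> \<sigma> j d * \<sigma> i c"
    and "proj_closure n U \<inter> hyperplane_at_infinity n = lagrange_point n (\<lambda>j. \<sigma> j \<alpha>) ` {1..n}"
proof -
  obtain S where curve: "moebius_curve n (\<lambda>j. \<sigma> j \<alpha>) (\<lambda>j. \<sigma> j a) (\<lambda>j. \<sigma> j b) (\<lambda>j. \<sigma> j c) (\<lambda>j. \<sigma> j d) S"
    and S: "hypercircle \<alpha> (Fract [:b, a:] [:d, c:]) = zariski_closure n S"
    by (rule hypercircle_moebius_curve[OF n sigma abcd])
  have deg: "curve_has_degree n (proj_closure n (zariski_closure n S)) n"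
    using U S n by (simp add: primitive_hypercircle_def Let_def)
  show poles: "\<sigma> j c * \<sigma> i d \<noteq> \<sigma> j d * \<sigma> i c" if "i \<in> {1..n}" "j \<in> {1..n}" "i \<noteq> j" for i j
    using moebius_curve.same_pole_not_degree[OF curve that] deg by blast
  show "proj_closure n U \<inter> hyperplane_at_infinity n = lagrange_point n (\<lambda>j. \<sigma> j \<alpha>) ` {1..n}"
    unfolding U(1) S by (rule moebius_curve.closure_at_infinity[OF curve poles])
qed

text \<open>The identity (a t + b) M = (t + d) sum_i p_i \<alpha>^i, conjugated by \<sigma>_k, is
  evaluated at -\<sigma>_j(d). Since M has base coefficients, this is a root of M; for k ~= j the
  poles differ, so the sum, which is Y_k of the point, must vanish.\<close>

lemma infinity_point_eq_lagrange_point: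
  fixes \<alpha> :: "'k::field_char_0 alg_closure"
  assumes n: "n = ext_degree (adjoin \<alpha>)" and sigma: "conjugating_automorphisms \<alpha> \<sigma>"
    and U: "primitive_hypercircle \<alpha> U" and gen: "generated_by \<alpha> U a b d p" and j: "j \<in> {1..n}"
  shows "infinity_point n (\<sigma> j) d p = lagrange_point n (\<lambda>j. \<sigma> j \<alpha>) j"
proof -
  let ?N = "normal_closure (adjoin \<alpha>)"
  let ?M = "minimal_poly (- d)"
  have abd: "a \<in> adjoin \<alpha>" "b \<in> adjoin \<alpha>" "d \<in> adjoin \<alpha>" "a * d - b \<noteq> 0"
    and Ueq: "U = hypercircle \<alpha> (Fract [:b, a:] [:d, 1:])"
    and fract: "Fract [:b, a:] [:d, 1:] = Fract (\<Sum>i<n. smult (\<alpha> ^ i) (ac_poly (p i))) (ac_poly ?M)"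
    using gen unfolding generated_by_def n by auto
  have one: "1 \<in> adjoin \<alpha>" using adjoin_base[of 1 \<alpha>] by simp
  have N: "a \<in> ?N" "b \<in> ?N" "1 \<in> ?N" "d \<in> ?N" "\<alpha> \<in> ?N"
    using abd one adjoin_generator[of \<alpha>] subset_normal_closure[of "adjoin \<alpha>"] by auto
  have emb: "base_embedding ?N (\<sigma> k)" if "k \<in> {1..n}" for k
    using conjugating_base_embedding[OF sigma] that n by simp
  interpret interpolation n "\<lambda>j. \<sigma> j \<alpha>"
    using sigma n by unfold_locales (auto simp: conjugating_automorphisms_def bij_betw_def)
  interpret j: base_embedding ?N "\<sigma> j" by (rule emb[OF j])
  have poles: "\<sigma> k d \<noteq> \<sigma> j d" if k: "k \<in> {1..n}" "k \<noteq> j" for k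
  proof -
    have "a * d - b * 1 \<noteq> 0" using abd(4) by simp
    from primitive_distinct_poles(1)[OF n sigma abd(1,2) one abd(3) this Ueq U k(1) j k(2)]
    show ?thesis using base_embedding.one[OF emb[OF k(1)]] j.one by auto
  qed
  define w where "w i = poly (ac_poly (p i)) (- d)" for i
  have w: "w i \<in> ?N" for i unfolding w_def by (rule j.poly_closed[OF j.closed(4)[OF N(4)]])
  have sw: "\<sigma> j (w i) = poly (ac_poly (p i)) (- \<sigma> j d)" for i
    unfolding w_def by (simp add: j.poly j.closed(4) j.uminus N(4))
  define v where "v = vec (n + 1) (\<lambda>i. if i < n then \<sigma> j (w i) else 0)"
  have v: "v \<in> carrier_vec (n + 1)" "v $ n = 0" by (simp_all add: v_def)
  have Yv: "power_vec n x \<bullet> v = (\<Sum>i<n. x ^ i * \<sigma> j (w i))" for x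
    by (simp add: power_vec_scalar_prod v_def)
  have "[:d, 1:] \<noteq> 0" "ac_poly ?M \<noteq> 0" by simp_all
  from fract[unfolded eq_fract(1)[OF this]]
  have eq: "[:b, a:] * ac_poly ?M = [:d, 1:] * (\<Sum>i<n. smult (\<alpha> ^ i) (ac_poly (p i)))"
    by (simp only: mult.commute)
  have zero: "power_vec n (\<sigma> k \<alpha>) \<bullet> v = 0" if k: "k \<in> {1..n}" "k \<noteq> j" for k
  proof -
    interpret k: base_embedding ?N "\<sigma> k" by (rule emb[OF k(1)])
    have "poly ([:\<sigma> k b, \<sigma> k a:] * ac_poly ?M) (- \<sigma> j d)
        = poly ([:\<sigma> k d, \<sigma> k 1:] * (\<Sum>i<n. smult (\<sigma> k \<alpha> ^ i) (ac_poly (p i)))) (- \<sigma> j d)"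
      by (rule arg_cong[OF k.conjugate_identity[OF N eq]])
    moreover have "poly (ac_poly ?M) (- \<sigma> j d) = 0"
      using j.poly[OF j.closed(4)[OF N(4)], of ?M] by (simp add: minimal_poly(2) j.zero j.uminus N(4))
    ultimately have "(\<sigma> k d - \<sigma> j d) * (\<Sum>i<n. \<sigma> k \<alpha> ^ i * \<sigma> j (w i)) = 0"
      by (auto simp: poly_sum sw k.one)
    then show ?thesis unfolding Yv using poles[OF k] by simp
  qed
  have nonzero: "power_vec n (\<sigma> j \<alpha>) \<bullet> v \<noteq> 0"
  proof -
    \<comment> \<open>For k = j both sides vanish at the pole, so the sum is read off from
      derivatives at -d, giving (b - a d) M'(-d). Only afterwards is \<sigma>_j applied.\<close>
    have "poly (pderiv ([:b, a:] * ac_poly ?M)) (- d) = (b - a * d) * poly (pderiv (ac_poly ?M)) (- d)"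
      unfolding pderiv_mult by (simp add: minimal_poly(2) pderiv_pCons algebra_simps)
    moreover have "poly (pderiv ([:d, 1:] * r)) (- d) = poly r (- d)" for r
      unfolding pderiv_mult by (simp add: pderiv_pCons)
    ultimately have "(b - a * d) * poly (pderiv (ac_poly ?M)) (- d) = (\<Sum>i<n. \<alpha> ^ i * w i)"
      unfolding eq by (simp only: poly_sum poly_smult w_def)
    moreover have "(b - a * d) * poly (pderiv (ac_poly ?M)) (- d) \<noteq> 0"
      using minimal_poly_simple_root[of "- d"] abd(4) by simp
    ultimately have "(\<Sum>i<n. \<alpha> ^ i * w i) \<noteq> 0" by simp
    moreover have closed: "\<alpha> ^ i * w i \<in> ?N" for i by (intro j.closed j.power_closed N w)
    ultimately have "\<sigma> j (\<Sum>i<n. \<alpha> ^ i * w i) \<noteq> 0"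
      by (subst j.eq_0_iff) (auto intro: j.sum_closed)
    moreover have "\<sigma> j (\<Sum>i<n. \<alpha> ^ i * w i) = (\<Sum>i<n. \<sigma> j \<alpha> ^ i * \<sigma> j (w i))"
      using closed by (simp add: j.sum j.mult j.power j.power_closed N w)
    ultimately show ?thesis unfolding Yv by simp
  qed
  have v0: "v \<noteq> 0\<^sub>v (n + 1)"
    using nonzero by (auto simp: power_vec_scalar_prod)
  have inf: "infinity_point n (\<sigma> j) d p = proj_point v"
    by (simp only: infinity_point_def v_def w_def)
  show ?thesis
    unfolding inf
  proof (rule lagrange_point_unique[OF _ j])
    show "proj_point v \<in> hyperplane_at_infinity n"
      unfolding hyperplane_at_infinity_def
      using proj_point_in_hyperplane[OF v(1) v0] v by simp
    show "proj_point v \<in> conj_hyperplane n (\<sigma> k \<alpha>)" if "k \<in> {1..n}" "k \<noteq> j" for k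
      unfolding conj_hyperplane_power_vec
      using proj_point_in_hyperplane[OF v(1) v0] zero[OF that] by simp
  qed
qed

text \<open>Quantifying \<open>P\<close> before \<open>U\<close> and its generators expresses
  independence of the hypercircle. The last conjunct states the characterization for labelled points
  at infinity alone, without reference to a curve.\<close>

theorem theorem4p2:
  fixes \<alpha> :: "'k::field_char_0 alg_closure"
    and \<sigma> :: "nat \<Rightarrow> 'k alg_closure \<Rightarrow> 'k alg_closure"
    and n :: nat
  assumes n: "n = ext_degree (adjoin \<alpha>)"
    and sigma: "conjugating_automorphisms \<alpha> \<sigma>"
  shows "\<exists>P. inj_on P {1..n} \<and> P ` {1..n} \<subseteq> hyperplane_at_infinity n \<and>
    (\<forall>U. primitive_hypercircle \<alpha> U \<longrightarrow>
       proj_closure n U \<inter> hyperplane_at_infinity n = P ` {1..n} \<and>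
       (\<forall>a b d p. generated_by \<alpha> U a b d p \<longrightarrow>
          (\<forall>j\<in>{1..n}. P j = infinity_point n (\<sigma> j) d p)) \<and>
       (\<forall>j\<in>{1..n}. (conj_hyperplane n (\<sigma> j \<alpha>) \<inter> hyperplane_at_infinity n) \<inter> proj_closure n U
          = P ` {1..n} - {P j}) \<and>
       (\<forall>Q. inj_on Q {1..n} \<and> Q ` {1..n} \<subseteq> hyperplane_at_infinity n \<and>
          (\<forall>j\<in>{1..n}. (conj_hyperplane n (\<sigma> j \<alpha>) \<inter> hyperplane_at_infinity n) \<inter> proj_closure n U
             = Q ` {1..n} - {Q j}) \<longrightarrow> (\<forall>j\<in>{1..n}. Q j = P j))) \<and>
    (\<forall>Q. inj_on Q {1..n} \<and> Q ` {1..n} \<subseteq> hyperplane_at_infinity n \<longrightarrow>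
       ((\<forall>j\<in>{1..n}. conj_hyperplane n (\<sigma> j \<alpha>) \<inter> Q ` {1..n} = Q ` {1..n} - {Q j})
          \<longleftrightarrow> (\<forall>j\<in>{1..n}. Q j = P j)))"
proof -
  interpret interpolation n "\<lambda>j. \<sigma> j \<alpha>"
    using sigma n by unfold_locales (auto simp: conjugating_automorphisms_def bij_betw_def)
  let ?P = "lagrange_point n (\<lambda>j. \<sigma> j \<alpha>)"
  let ?H = "hyperplane_at_infinity n :: 'k alg_closure vec set set"
  let ?C = "\<lambda>j. conj_hyperplane n (\<sigma> j \<alpha>)"
  have P_inf: "?P ` {1..n} \<subseteq> ?H" using lagrange_point_at_infinity by blast
  have P_char: "?C j \<inter> ?P ` {1..n} = ?P ` {1..n} - {?P j}" if j: "j \<in> {1..n}" for j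
  proof -
    have "R \<in> ?C j \<longleftrightarrow> R \<noteq> ?P j" if "R \<in> ?P ` {1..n}" for R
    proof -
      from that obtain k where k: "k \<in> {1..n}" and R: "R = ?P k" by blast
      show ?thesis
        unfolding R inj_on_eq_iff[OF inj_on_lagrange_point k j]
        using lagrange_point_conj_hyperplane[OF k j] by auto
    qed
    then show ?thesis by blast
  qed
  have closure: "proj_closure n U \<inter> ?H = ?P ` {1..n}" if U: "primitive_hypercircle \<alpha> U" for U
  proof -
    obtain a b c d where "a \<in> adjoin \<alpha>" "b \<in> adjoin \<alpha>" "c \<in> adjoin \<alpha>" "d \<in> adjoin \<alpha>" "a * d - b * c \<noteq> 0"
      "U = hypercircle \<alpha> (Fract [:b, a:] [:d, c:])"
      using U by (auto simp: primitive_hypercircle_def is_hypercircle_def is_unit_over_def)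
    from primitive_distinct_poles(2)[OF n sigma this U] show ?thesis .
  qed
  \<comment> \<open>Both uniqueness claims, relative to a curve and without one, reduce to this
    inclusion into the hyperplanes.\<close>
  have unique: "\<forall>j\<in>{1..n}. Q j = ?P j"
    if inj: "inj_on Q {1..n}" and sub: "Q ` {1..n} \<subseteq> ?H"
      and Q: "\<And>j. j \<in> {1..n} \<Longrightarrow> Q ` {1..n} - {Q j} \<subseteq> ?C j" for Q
  proof
    fix j assume j: "j \<in> {1..n}"
    show "Q j = ?P j"
    proof (rule lagrange_point_unique[OF _ j])
      show "Q j \<in> ?H" using sub j by blast
      fix k assume k: "k \<in> {1..n}" "k \<noteq> j"
      have "Q j \<noteq> Q k" using inj_on_eq_iff[OF inj j k(1)] k(2) by simp
      then show "Q j \<in> ?C k" using Q[OF k(1)] j by blast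
    qed
  qed
  show ?thesis
  proof (intro exI[of _ ?P] conjI allI impI)
    show "inj_on ?P {1..n}" by (rule inj_on_lagrange_point)
    show "?P ` {1..n} \<subseteq> ?H" by (rule P_inf)
  next
    fix U assume U: "primitive_hypercircle \<alpha> U"
    show "proj_closure n U \<inter> ?H = ?P ` {1..n}" by (rule closure[OF U])
  next
    fix U a b d p assume U: "primitive_hypercircle \<alpha> U" and gen: "generated_by \<alpha> U a b d p"
    show "\<forall>j\<in>{1..n}. ?P j = infinity_point n (\<sigma> j) d p"
      using infinity_point_eq_lagrange_point[OF n sigma U gen] by simp
  next
    fix U assume U: "primitive_hypercircle \<alpha> U"
    show "\<forall>j\<in>{1..n}. (?C j \<inter> ?H) \<inter> proj_closure n U = ?P ` {1..n} - {?P j}"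
      using P_char closure[OF U] by blast
  next
    fix U Q
    assume U: "primitive_hypercircle \<alpha> U"
      and Q: "inj_on Q {1..n} \<and> Q ` {1..n} \<subseteq> ?H \<and>
        (\<forall>j\<in>{1..n}. (?C j \<inter> ?H) \<inter> proj_closure n U = Q ` {1..n} - {Q j})"
    then show "\<forall>j\<in>{1..n}. Q j = ?P j" by (intro unique) blast+
  next
    fix Q assume Q: "inj_on Q {1..n} \<and> Q ` {1..n} \<subseteq> ?H"
    show "(\<forall>j\<in>{1..n}. ?C j \<inter> Q ` {1..n} = Q ` {1..n} - {Q j}) \<longleftrightarrow> (\<forall>j\<in>{1..n}. Q j = ?P j)"
    proof
      assume "\<forall>j\<in>{1..n}. ?C j \<inter> Q ` {1..n} = Q ` {1..n} - {Q j}"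
      with Q show "\<forall>j\<in>{1..n}. Q j = ?P j" by (intro unique) blast+
    next
      assume eq: "\<forall>j\<in>{1..n}. Q j = ?P j"
      then have "Q ` {1..n} = ?P ` {1..n}" by (intro image_cong) auto
      with eq P_char show "\<forall>j\<in>{1..n}. ?C j \<inter> Q ` {1..n} = Q ` {1..n} - {Q j}" by simp
    qed
  qed
qed

end
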